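(* Let $W$ be a graphon with $W=p$ almost everywhere for some $p\in(0,1)$, let $G_n\sim G(n,W)$, and let $\hat f(G_n)=\hat t(K_2,G_n)^4-\hat t(C_4,G_n)$. Then, as $n\to\infty$, $$n^{3/2}\hat f(G_n)\xrightarrow{D}N(0,\vartheta^2),\qquad \vartheta^2:=32\,t(K_2,W)^6(1-t(K_2,W))^2.$$
   Context: A graphon is a measurable symmetric function $W:[0,1]^2\to[0,1]$. $G(n,W)$ is the random graph on $\{1,\dots,n\}$ obtained from independent i.i.d. $U[0,1]$ families $(U_i)_{i\le n}$ and $(Y_{ij})_{i<j\le n}$ by putting the edge $(i,j)$ iff $Y_{ij}\le W(U_i,U_j)$. $K_2$ is the edge and $C_4$ the 4-cycle. For a finite simple graph $H$, $X(H,G_n)$ is the number of unlabelled (not necessarily induced) copies of $H$ in $G_n$, $\hat t(H,G_n)=\frac{|\mathrm{Aut}(H)|}{(n)_{|V(H)|}}X(H,G_n)$ with $(n)_k=n(n-1)\cdots(n-k+1)$ and $\mathrm{Aut}(H)$ the automorphism group, and $t(K_2,W)=\int_{[0,1]^2}W(x,y)\,\mathrm dx\,\mathrm dy$. *)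

theory Defs
  imports "HOL-Probability.Probability"
begin

type_synonym 'v graph = "'v set \<times> 'v set set"

abbreviation (input) verts :: "'v graph \<Rightarrow> 'v set" where "verts \<equiv> fst"
abbreviation (input) edges :: "'v graph \<Rightarrow> 'v set set" where "edges \<equiv> snd"

definition simple_graphs_on :: "'v set \<Rightarrow> 'v graph set" where
  "simple_graphs_on V = {G. verts G = V \<and> edges G \<subseteq> {e. e \<subseteq> V \<and> card e = 2}}"

definition isomorphic :: "'v graph \<Rightarrow> 'w graph \<Rightarrow> bool" where
  "isomorphic H K \<longleftrightarrow>
     (\<exists>\<phi>. bij_betw \<phi> (verts H) (verts K) \<and> (\<lambda>e. \<phi> ` e) ` edges H = edges K)"

definition automorphisms :: "'v graph \<Rightarrow> ('v \<Rightarrow> 'v) set" where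
  "automorphisms H = {\<phi>. \<phi> permutes verts H \<and> (\<lambda>e. \<phi> ` e) ` edges H = edges H}"

(* Unlabelled copies: each (not necessarily induced) subgraph of G isomorphic to H counts once. *)
definition copies :: "'v graph \<Rightarrow> 'w graph \<Rightarrow> 'w graph set" where
  "copies H G = {K. verts K \<subseteq> verts G \<and> edges K \<subseteq> edges G \<and> isomorphic H K}"

definition falling_factorial :: "nat \<Rightarrow> nat \<Rightarrow> real" where
  "falling_factorial n k = (\<Prod>i<k. real n - real i)"

definition t_hat :: "'v graph \<Rightarrow> 'w graph \<Rightarrow> real" where
  "t_hat H G = real (card (automorphisms H)) / falling_factorial (card (verts G)) (card (verts H))
     * real (card (copies H G))"

definition K2 :: "nat graph" where
  "K2 = ({1, 2}, {{1, 2}})"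

definition C4 :: "nat graph" where
  "C4 = ({1, 2, 3, 4}, {{1, 2}, {2, 3}, {3, 4}, {4, 1}})"

definition f_hat :: "'v graph \<Rightarrow> real" where
  "f_hat G = t_hat K2 G ^ 4 - t_hat C4 G"

abbreviation unit_square :: "(real \<times> real) set" where
  "unit_square \<equiv> {0..1} \<times> {0..1}"

(* Only the values on the unit square matter; measurability is with respect to the Borel sets. *)
definition graphon :: "(real \<times> real \<Rightarrow> real) \<Rightarrow> bool" where
  "graphon W \<longleftrightarrow>
     W \<in> borel_measurable (restrict_space borel unit_square) \<and>
     (\<forall>x\<in>{0..1}. \<forall>y\<in>{0..1}. W (x, y) = W (y, x)) \<and>
     (\<forall>z\<in>unit_square. W z \<in> {0..1})"

definition t_K2 :: "(real \<times> real \<Rightarrow> real) \<Rightarrow> real" where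
  "t_K2 W = (LINT z:unit_square|lborel. W z)"

(* The U[0,1] law, with underlying space {0..1} rather than the whole real line, since a graphon
   is unconstrained off the unit square. *)
definition uniform01 :: "real measure" where
  "uniform01 = restrict_space lborel {0..1}"

abbreviation vertex_pairs :: "nat \<Rightarrow> (nat \<times> nat) set" where
  "vertex_pairs n \<equiv> {(i, j). 1 \<le> i \<and> i < j \<and> j \<le> n}"

(* Joint law of the independent i.i.d. U[0,1] families (U_i) and (Y_ij) indexed by i <= n
   and by i < j <= n. *)
definition label_space :: "nat \<Rightarrow> ((nat \<Rightarrow> real) \<times> (nat \<times> nat \<Rightarrow> real)) measure" where
  "label_space n =
     (\<Pi>\<^sub>M i\<in>{1..n}. uniform01) \<Otimes>\<^sub>M (\<Pi>\<^sub>M ij\<in>vertex_pairs n. uniform01)"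

definition sample_graph ::
  "nat \<Rightarrow> (real \<times> real \<Rightarrow> real) \<Rightarrow> (nat \<Rightarrow> real) \<times> (nat \<times> nat \<Rightarrow> real) \<Rightarrow> nat graph" where
  "sample_graph n W = (\<lambda>(U, Y).
     ({1..n}, {{i, j} | i j. (i, j) \<in> vertex_pairs n \<and> Y (i, j) \<le> W (U i, U j)}))"

definition random_graph :: "nat \<Rightarrow> (real \<times> real \<Rightarrow> real) \<Rightarrow> nat graph measure" where
  "random_graph n W =
     distr (label_space n) (count_space (simple_graphs_on {1..n})) (sample_graph n W)"

lemma prob_space_uniform01: "prob_space uniform01"
  unfolding uniform01_def by (rule prob_spaceI) (simp add: emeasure_restrict_space space_restrict_space)

lemma prob_space_label_space: "prob_space (label_space n)"
proof -
  interpret A: prob_space "\<Pi>\<^sub>M i\<in>{1..n}. uniform01"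
    by (intro prob_space_PiM prob_space_uniform01)
  interpret B: prob_space "\<Pi>\<^sub>M ij\<in>vertex_pairs n. uniform01"
    by (intro prob_space_PiM prob_space_uniform01)
  interpret P: pair_prob_space "\<Pi>\<^sub>M i\<in>{1..n}. uniform01" "\<Pi>\<^sub>M ij\<in>vertex_pairs n. uniform01" ..
  show ?thesis unfolding label_space_def by (rule P.prob_space_axioms)
qed

lemma finite_simple_graphs_on: "finite V \<Longrightarrow> finite (simple_graphs_on V)"
  by (rule finite_subset[of _ "{V} \<times> Pow (Pow V)"]) (auto simp: simple_graphs_on_def)

lemma sample_graph_edge_iff:
  assumes "(i, j) \<in> vertex_pairs n"
  shows "{i, j} \<in> edges (sample_graph n W (U, Y)) \<longleftrightarrow> Y (i, j) \<le> W (U i, U j)"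
  using assms by (auto simp: sample_graph_def doubleton_eq_iff)

lemma sample_graph_in: "sample_graph n W \<omega> \<in> simple_graphs_on {1..n}"
  by (cases \<omega>) (auto simp: sample_graph_def simple_graphs_on_def)

lemma measurable_sample_graph:
  assumes "graphon W"
  shows "sample_graph n W \<in> measurable (label_space n) (count_space (simple_graphs_on {1..n}))"
proof -
  let ?L = "label_space n"
  have sp: "space uniform01 = {0..1}" by (simp add: uniform01_def space_restrict_space)
  have id01: "(\<lambda>x. x) \<in> borel_measurable uniform01"
    unfolding uniform01_def by (rule measurable_restrict_space1) simp
  have U: "(\<lambda>\<omega>. fst \<omega> i) \<in> measurable ?L uniform01" if "i \<in> {1..n}" for i
    using that unfolding label_space_def by measurable
  have Y: "(\<lambda>\<omega>. snd \<omega> e) \<in> measurable ?L uniform01" if "e \<in> vertex_pairs n" for e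
    using that unfolding label_space_def by measurable
  have ev: "{\<omega> \<in> space ?L. snd \<omega> (i, j) \<le> W (fst \<omega> i, fst \<omega> j)} \<in> sets ?L"
    if ij: "(i, j) \<in> vertex_pairs n" for i j
  proof -
    have i: "i \<in> {1..n}" and j: "j \<in> {1..n}" using ij by auto
    have "(\<lambda>\<omega>. (fst \<omega> i, fst \<omega> j)) \<in> measurable ?L (restrict_space borel unit_square)"
    proof (rule measurable_restrict_space2)
      show "(\<lambda>\<omega>. (fst \<omega> i, fst \<omega> j)) \<in> space ?L \<rightarrow> unit_square"
        using measurable_space[OF U[OF i]] measurable_space[OF U[OF j]] by (auto simp: sp)
      show "(\<lambda>\<omega>. (fst \<omega> i, fst \<omega> j)) \<in> borel_measurable ?L"
        using measurable_compose[OF U[OF i] id01] measurable_compose[OF U[OF j] id01]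
        by (rule borel_measurable_Pair)
    qed
    then have "(\<lambda>\<omega>. W (fst \<omega> i, fst \<omega> j)) \<in> borel_measurable ?L"
      using assms by (rule_tac measurable_compose) (auto simp: graphon_def)
    with measurable_compose[OF Y[OF ij] id01] show ?thesis
      by (rule borel_measurable_le)
  qed
  have fin: "finite (vertex_pairs n)"
    by (rule finite_subset[of _ "{1..n} \<times> {1..n}"]) auto
  show ?thesis
  proof (rule measurable_count_space_eq2[THEN iffD2, OF finite_simple_graphs_on])
    show "sample_graph n W \<in> space ?L \<rightarrow> simple_graphs_on {1..n} \<and>
      (\<forall>G\<in>simple_graphs_on {1..n}. sample_graph n W -` {G} \<inter> space ?L \<in> sets ?L)"
    proof (intro conjI ballI)
      fix G :: "nat graph" assume G: "G \<in> simple_graphs_on {1..n}"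
      have E: "sample_graph n W \<omega> = G \<longleftrightarrow>
        (\<forall>(i,j)\<in>vertex_pairs n. snd \<omega> (i, j) \<le> W (fst \<omega> i, fst \<omega> j) \<longleftrightarrow> {i, j} \<in> edges G)"
        (is "?l \<longleftrightarrow> ?r") for \<omega>
      proof
        assume ?l then show ?r
          using sample_graph_edge_iff[of _ _ n W "fst \<omega>" "snd \<omega>"] by auto
      next
        assume r: ?r
        have "edges (sample_graph n W \<omega>) = edges G"
        proof (intro set_eqI)
          fix e
          show "e \<in> edges (sample_graph n W \<omega>) \<longleftrightarrow> e \<in> edges G"
          proof (cases "e \<subseteq> {1..n} \<and> card e = 2")
            case True
            then obtain a b where ab: "e = {a, b}" "a \<noteq> b" by (auto simp: card_2_iff)
            define i j where "i = min a b" and "j = max a b"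
            have e: "e = {i, j}" using ab by (auto simp: i_def j_def min_def max_def)
            have ij: "(i, j) \<in> vertex_pairs n"
              using ab True by (auto simp: i_def j_def min_def max_def)
            show ?thesis
              using r[rule_format, OF ij] sample_graph_edge_iff[OF ij, of W "fst \<omega>" "snd \<omega>"] e
              by simp
          next
            case False
            then show ?thesis
              using G sample_graph_in[of n W \<omega>] by (auto simp: simple_graphs_on_def)
          qed
        qed
        moreover have "verts (sample_graph n W \<omega>) = verts G"
          using G sample_graph_in[of n W \<omega>] by (auto simp: simple_graphs_on_def)
        ultimately show ?l by (rule prod_eqI[rotated])
      qed
      let ?A = "\<lambda>ij. {\<omega> \<in> space ?L. snd \<omega> ij \<le> W (fst \<omega> (fst ij), fst \<omega> (snd ij)) \<longleftrightarrow>
        {fst ij, snd ij} \<in> edges G}"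
      have A: "?A ij \<in> sets ?L" if ij: "ij \<in> vertex_pairs n" for ij
      proof (cases "{fst ij, snd ij} \<in> edges G")
        case True
        then show ?thesis using ev[of "fst ij" "snd ij"] ij by (auto simp: case_prod_beta)
      next
        case False
        then show ?thesis
          using sets.sets_Collect_neg[OF ev[of "fst ij" "snd ij"]] ij by (auto simp: case_prod_beta)
      qed
      have "{\<omega> \<in> space ?L. \<forall>ij\<in>vertex_pairs n. snd \<omega> ij \<le> W (fst \<omega> (fst ij), fst \<omega> (snd ij)) \<longleftrightarrow>
          {fst ij, snd ij} \<in> edges G} \<in> sets ?L"
        by (rule sets.sets_Collect_finite_All) (use A fin in auto)
      also have "{\<omega> \<in> space ?L. \<forall>ij\<in>vertex_pairs n. snd \<omega> ij \<le> W (fst \<omega> (fst ij), fst \<omega> (snd ij)) \<longleftrightarrow>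
          {fst ij, snd ij} \<in> edges G} = sample_graph n W -` {G} \<inter> space ?L"
        using E by auto
      finally show "sample_graph n W -` {G} \<inter> space ?L \<in> sets ?L" .
    qed (use sample_graph_in in auto)
  qed simp
qed

lemma prob_space_random_graph: "graphon W \<Longrightarrow> prob_space (random_graph n W)"
  unfolding random_graph_def
  by (intro prob_space.prob_space_distr prob_space_label_space measurable_sample_graph)

end

theory Submission
  imports Defs "HOL-Real_Asymp.Real_Asymp"
begin

text \<open>
Since \<open>W = p\<close> almost everywhere, the edges of the random graph are independent with
probability \<open>p\<close>. Write \<open>\<epsilon>\<^sub>e\<close> for the centred indicator of the edge \<open>e\<close> and
\<open>\<sigma>\<^sup>2 = p (1 - p)\<close> for its variance. In the expansion of \<open>t_hat K2 ^ 4 - t_hat C4\<close> in these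
variables the constant terms and the linear terms cancel, which is why the fluctuations are of
order \<open>n powr (-3/2)\<close> and not \<open>1 / n\<close>. The leading term is \<open>- 4 p\<^sup>2\<close> times the average of
\<open>\<epsilon>\<^sub>a\<^sub>b \<epsilon>\<^sub>b\<^sub>c\<close> over the paths \<open>a, b, c\<close>. Everything else has first absolute moment of order
\<open>1 / n\<^sup>2\<close>: products of noise over different edge sets are orthogonal, and when an edge set touches
all four vertices of a 4-tuple, boundedly many of the order \<open>n\<^sup>4\<close> tuples give the same edge set
(\<open>expect_tuples4_le\<close>, \<open>expect_f_hat_error_le\<close>).

What remains is a central limit theorem for \<open>S\<close>, the sum of \<open>\<epsilon>\<^sub>e \<epsilon>\<^sub>f\<close> over the unordered pairs of
edges with a common vertex. This is a quadratic form on the line graph of the complete graph,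
which is regular of degree \<open>d = 2 (n - 2)\<close> on \<open>N = n (n - 1) / 2\<close> vertices. Such quadratic forms
are asymptotically normal on all regular graphs with \<open>d / N \<longlonglongrightarrow> 0\<close> (\<open>char_quadratic_form\<close>), by the
method of Stein and Tikhomirov. Let \<open>\<phi> u\<close> be the expectation of \<open>iexp (u * S)\<close>, so that \<open>\<phi>' u\<close> is \<open>\<i>\<close> times
that of \<open>S * iexp (u * S)\<close>. The variable \<open>\<epsilon>\<^sub>a\<close> enters \<open>S\<close> through \<open>\<epsilon>\<^sub>a L\<^sub>a\<close> only, with \<open>L\<^sub>a\<close>
the sum of the noise over the neighbours of \<open>a\<close>. Expanding \<open>iexp (u \<epsilon>\<^sub>a L\<^sub>a)\<close> to first order and
using that \<open>\<epsilon>\<^sub>a\<close> is independent of the rest turns \<open>\<epsilon>\<^sub>a L\<^sub>a\<close> into \<open>\<i> u \<sigma>\<^sup>2 L\<^sub>a\<^sup>2\<close>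
(\<open>edge_estimate\<close>). The sum of the \<open>L\<^sub>a\<^sup>2\<close> is concentrated around its mean \<open>N d \<sigma>\<^sup>2\<close> because
\<open>d / N\<close> is small (\<open>expect_Z_squared_le\<close>). Hence \<open>\<phi>' u\<close> is close to \<open>- u s\<^sup>2 \<phi> u\<close> with
\<open>s\<^sup>2 = \<sigma>\<^sup>4 N d / 2\<close>, the differential equation of the Gaussian characteristic function, and an explicit error
bound for \<open>\<phi>\<close> follows by integration (\<open>norm_diff_gaussian_le\<close>).

With \<open>m = n (n - 1) (n - 2)\<close> the leading term equals \<open>- 8 p\<^sup>2 S / m\<close> and \<open>s\<^sup>2 = \<sigma>\<^sup>4 m / 2\<close>. After
multiplication by \<open>n powr (3/2)\<close> its variance therefore tends to \<open>32 p\<^sup>4 \<sigma>\<^sup>4 = 32 p\<^sup>6 (1 - p)\<^sup>2\<close>, and Levy's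
continuity theorem gives the claim. Two reductions precede this argument: subgraph counts are sums
over tuples of distinct vertices (\<open>card_embeddings\<close>), and the law of the random graph is that of
independent edges (\<open>random_graph_almost_constant\<close>).
\<close>

section \<open>Gaussian characteristic functions\<close>

text \<open>The function \<open>exp (t\<^sup>2 / 2) * \<psi> t\<close> has derivative \<open>exp (t\<^sup>2 / 2) * (\<psi>' t + t * \<psi> t)\<close>, which
  is small by assumption. The factor \<open>exp (t\<^sup>2 / 2)\<close> lost in the mean value inequality is regained when
  the bound is multiplied by \<open>exp (- t\<^sup>2 / 2)\<close>, so the error stays polynomial in \<open>t\<close>.\<close>

lemma norm_diff_gaussian_le:
  fixes \<psi> \<psi>' :: "real \<Rightarrow> complex"
  assumes deriv: "\<And>t. (\<psi> has_vector_derivative \<psi>' t) (at t)"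
    and init: "\<psi> 0 = 1"
    and ode: "\<And>t. norm (\<psi>' t + t *\<^sub>R \<psi> t) \<le> \<delta> * (\<bar>t\<bar> + t\<^sup>2)"
  shows "norm (\<psi> t - complex_of_real (exp (- t\<^sup>2 / 2))) \<le> \<delta> * (t\<^sup>2 + \<bar>t\<bar> ^ 3)"
proof -
  define F where "F = (\<lambda>s. exp (s\<^sup>2 / 2) *\<^sub>R \<psi> s)"
  define F' where "F' = (\<lambda>s. exp (s\<^sup>2 / 2) *\<^sub>R (\<psi>' s + s *\<^sub>R \<psi> s))"
  have dF: "(F has_vector_derivative F' s) (at s)" for s
    unfolding F_def F'_def
    by (auto intro!: derivative_eq_intros deriv simp: scaleR_add_right mult_ac)
  have \<delta>: "0 \<le> \<delta>" using order_trans[OF norm_ge_zero ode[of 1]] by simp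
  have "norm (F t - F 0) \<le> (exp (t\<^sup>2 / 2) * (\<delta> * (\<bar>t\<bar> + t\<^sup>2))) * norm (t - 0)"
  proof (rule differentiable_bound[where S = "{-\<bar>t\<bar>..\<bar>t\<bar>}" and f' = "\<lambda>s h. h *\<^sub>R F' s"])
    fix s assume s: "s \<in> {-\<bar>t\<bar>..\<bar>t\<bar>}"
    show "(F has_derivative (\<lambda>h. h *\<^sub>R F' s)) (at s within {-\<bar>t\<bar>..\<bar>t\<bar>})"
      using dF[of s] unfolding has_vector_derivative_def by (rule has_derivative_at_withinI)
    have st: "s\<^sup>2 \<le> t\<^sup>2" "\<bar>s\<bar> \<le> \<bar>t\<bar>" using s by (auto simp: abs_le_square_iff[symmetric])
    have "norm (F' s) = exp (s\<^sup>2 / 2) * norm (\<psi>' s + s *\<^sub>R \<psi> s)"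
      by (simp add: F'_def)
    also have "\<dots> \<le> exp (t\<^sup>2 / 2) * (\<delta> * (\<bar>t\<bar> + t\<^sup>2))"
      using st \<delta> by (intro mult_mono order_trans[OF ode] mult_left_mono) auto
    finally show "onorm (\<lambda>h. h *\<^sub>R F' s) \<le> exp (t\<^sup>2 / 2) * (\<delta> * (\<bar>t\<bar> + t\<^sup>2))"
      by (intro onorm_le) (simp add: mult_left_mono mult.commute)
  qed auto
  hence "exp (- t\<^sup>2 / 2) * norm (F t - 1) \<le>
      exp (- t\<^sup>2 / 2) * ((exp (t\<^sup>2 / 2) * (\<delta> * (\<bar>t\<bar> + t\<^sup>2))) * \<bar>t\<bar>)"
    by (intro mult_left_mono) (auto simp: F_def init)
  also have "\<dots> = (exp (- t\<^sup>2 / 2) * exp (t\<^sup>2 / 2)) * (\<delta> * (\<bar>t\<bar> + t\<^sup>2) * \<bar>t\<bar>)"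
    by (simp only: mult_ac)
  also have "exp (- t\<^sup>2 / 2) * exp (t\<^sup>2 / 2) = 1"
    by (simp add: exp_add[symmetric])
  also have "1 * (\<delta> * (\<bar>t\<bar> + t\<^sup>2) * \<bar>t\<bar>) = \<delta> * (t\<^sup>2 + \<bar>t\<bar> ^ 3)"
    by (simp add: power2_eq_square power3_eq_cube algebra_simps abs_mult_self_eq)
  finally have *: "exp (- t\<^sup>2 / 2) * norm (F t - 1) \<le> \<delta> * (t\<^sup>2 + \<bar>t\<bar> ^ 3)" .
  have "exp (- t\<^sup>2 / 2) *\<^sub>R (F t - 1) =
      (exp (- t\<^sup>2 / 2) * exp (t\<^sup>2 / 2)) *\<^sub>R \<psi> t - complex_of_real (exp (- t\<^sup>2 / 2))"
    unfolding F_def scaleR_diff_right scaleR_scaleR by (simp add: scaleR_conv_of_real)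
  also have "exp (- t\<^sup>2 / 2) * exp (t\<^sup>2 / 2) = 1"
    by (simp add: exp_add[symmetric])
  finally have "norm (\<psi> t - complex_of_real (exp (- t\<^sup>2 / 2))) = norm (exp (- t\<^sup>2 / 2) *\<^sub>R (F t - 1))"
    by simp
  with * show ?thesis by (simp only: norm_scaleR abs_exp_cancel)
qed

lemma norm_iexp_minus_1_le: "norm (iexp y - 1) \<le> \<bar>y\<bar>"
  using iexp_approx1[of y 0] by simp

lemma norm_iexp_minus_linear_le: "norm (iexp y - 1 - \<i> * y) \<le> y\<^sup>2 / 2"
  using iexp_approx1[of y 1] by (simp add: numeral_2_eq_2 algebra_simps)

lemma norm_iexp_diff_le: "norm (iexp a - iexp b) \<le> \<bar>a - b\<bar>"
proof -
  have "iexp a - iexp b = iexp b * (iexp (a - b) - 1)"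
    by (simp add: exp_add[symmetric] algebra_simps)
  hence "norm (iexp a - iexp b) = norm (iexp (a - b) - 1)"
    by (simp only: norm_mult norm_exp_i_times mult_1)
  thus ?thesis using norm_iexp_minus_1_le[of "a - b"] by simp
qed

lemma char_normal:
  assumes "0 < \<sigma>"
  shows "char (density lborel (\<lambda>x. ennreal (normal_density 0 \<sigma> x))) t =
    complex_of_real (exp (- (t * \<sigma>)\<^sup>2 / 2))"
proof -
  interpret std: real_distribution std_normal_distribution
    by (rule real_dist_normal_dist)
  have "distributed std_normal_distribution lborel (\<lambda>x. x) std_normal_density"
    by (auto simp: distributed_def distr_id2)
  from std.normal_density_affine[OF this, of \<sigma> 0] assms
  have "distributed std_normal_distribution lborel (\<lambda>x. \<sigma> * x) (normal_density 0 \<sigma>)"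
    by simp
  hence eq: "density lborel (\<lambda>x. ennreal (normal_density 0 \<sigma> x)) =
      distr std_normal_distribution lborel (\<lambda>x. \<sigma> * x)"
    by (simp add: distributed_distr_eq_density)
  have "char (density lborel (\<lambda>x. ennreal (normal_density 0 \<sigma> x))) t =
      char std_normal_distribution (t * \<sigma>)"
    unfolding char_def eq by (subst integral_distr) (auto simp: mult_ac)
  thus ?thesis by (simp add: char_std_normal_distribution)
qed

section \<open>Centred Bernoulli variables\<close>

lemma finite_set_Pi_pmf_bool:
  assumes "finite A"
  shows "finite (set_pmf (Pi_pmf A False (q :: 'e \<Rightarrow> bool pmf)))"
  using set_Pi_pmf_subset'[OF assms, of False q]
  by (rule finite_subset) (use assms in auto)

lemma square_sum3_le: "(a + b + c)\<^sup>2 \<le> 3 * (a\<^sup>2 + b\<^sup>2 + c\<^sup>2)" for a b c :: real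
proof -
  have "3 * (a\<^sup>2 + b\<^sup>2 + c\<^sup>2) - (a + b + c)\<^sup>2 = (a - b)\<^sup>2 + (b - c)\<^sup>2 + (a - c)\<^sup>2"
    by (simp add: power2_eq_square algebra_simps)
  moreover have "0 \<le> (a - b)\<^sup>2 + (b - c)\<^sup>2 + (a - c)\<^sup>2" by simp
  ultimately show ?thesis by linarith
qed

locale bernoulli_family =
  fixes E :: "'e set" and p :: real
  assumes finite_E: "finite E" and p_pos: "0 < p" and p_less_1: "p < 1"
begin

definition P :: "('e \<Rightarrow> bool) pmf" where
  "P = Pi_pmf E False (\<lambda>_. bernoulli_pmf p)"

abbreviation expect :: "(('e \<Rightarrow> bool) \<Rightarrow> 'b::{banach, second_countable_topology}) \<Rightarrow> 'b" where
  "expect f \<equiv> measure_pmf.expectation P f"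

definition noise :: "'e \<Rightarrow> ('e \<Rightarrow> bool) \<Rightarrow> real" where
  "noise e x = of_bool (x e) - p"

definition var :: real where
  "var = p * (1 - p)"

lemma var_pos: "0 < var" and var_le_1: "var \<le> 1"
  using p_pos p_less_1 by (auto simp: var_def mult_le_one)

lemma abs_noise_le_1: "\<bar>noise e x\<bar> \<le> 1"
  using p_pos p_less_1 by (auto simp: noise_def)

text \<open>A variable with two values satisfies a quadratic equation. So powers of the noise reduce to
  the noise itself and a constant, and moments of polynomials come down to the orthogonality of
  products of distinct noise variables.\<close>

lemma noise_squared: "(noise e x)\<^sup>2 = var + (1 - 2 * p) * noise e x"
  by (cases "x e") (auto simp: noise_def var_def power2_eq_square algebra_simps)

lemma noise_fun_upd_other: "e \<noteq> a \<Longrightarrow> noise e (x(a := v)) = noise e x"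
  by (simp add: noise_def)

lemma finite_set_P: "finite (set_pmf P)"
  unfolding P_def by (rule finite_set_Pi_pmf_bool[OF finite_E])

lemma integrable_P [simp]: "integrable (measure_pmf P) f"
  for f :: "_ \<Rightarrow> 'b::{banach, second_countable_topology}"
  by (rule integrable_measure_pmf_finite[OF finite_set_P])

text \<open>Given all coordinates other than \<open>a\<close>, the noise at \<open>a\<close> has mean zero. Independence of the
  coordinates enters the estimates below in this form only.\<close>

lemma expect_noise_scaleR:
  fixes g :: "('e \<Rightarrow> bool) \<Rightarrow> 'b::{banach, second_countable_topology}"
  assumes a: "a \<in> E" and g: "\<And>x v. g (x(a := v)) = g x"
  shows "expect (\<lambda>x. noise a x *\<^sub>R g x) = 0"
proof -
  define Q where "Q = Pi_pmf (E - {a}) False (\<lambda>_. bernoulli_pmf p)"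
  have finQ: "finite (set_pmf Q)"
    unfolding Q_def by (rule finite_set_Pi_pmf_bool) (use finite_E in simp)
  have P: "P = bernoulli_pmf p \<bind> (\<lambda>y. map_pmf (\<lambda>f. f(a := y)) Q)"
    using Pi_pmf_insert'[of "E - {a}" a False "\<lambda>_. bernoulli_pmf p"] finite_E a
    by (simp add: P_def Q_def insert_absorb map_pmf_def)
  have "expect (\<lambda>x. noise a x *\<^sub>R g x) =
    (\<Sum>y\<in>UNIV. pmf (bernoulli_pmf p) y *\<^sub>R
       measure_pmf.expectation (map_pmf (\<lambda>f. f(a := y)) Q) (\<lambda>x. noise a x *\<^sub>R g x))"
    unfolding P using finQ by (intro pmf_expectation_bind) auto
  also have "\<dots> = (\<Sum>y\<in>UNIV. pmf (bernoulli_pmf p) y *\<^sub>R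
       ((of_bool y - p) *\<^sub>R measure_pmf.expectation Q g))"
    by (simp add: noise_def g)
  also have "\<dots> = 0"
    using p_pos p_less_1 by (simp add: UNIV_bool algebra_simps)
  finally show ?thesis .
qed

lemma expect_mono: "(\<And>x. f x \<le> g x) \<Longrightarrow> expect f \<le> expect g" for f g :: "_ \<Rightarrow> real"
  by (rule integral_mono) auto

lemma expect_norm_le: "norm (expect f) \<le> expect (\<lambda>x. norm (f x))"
  for f :: "_ \<Rightarrow> 'b::{banach, second_countable_topology}"
  by (rule integral_norm_bound)

text \<open>The Walsh functions, without normalisation: an orthogonal system on the product space.\<close>

definition chi :: "'e set \<Rightarrow> ('e \<Rightarrow> bool) \<Rightarrow> real" where
  "chi A x = (\<Prod>e\<in>A. noise e x)"

lemma abs_chi_le_1: "\<bar>chi A x\<bar> \<le> 1"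
  unfolding chi_def abs_prod by (rule prod_le_1) (auto simp: abs_noise_le_1)

lemma chi_singleton [simp]: "chi {e} x = noise e x"
  by (simp add: chi_def)

lemma chi_doubleton: "e \<noteq> f \<Longrightarrow> chi {e, f} x = noise e x * noise f x"
  by (simp add: chi_def)

lemma expect_chi_chi_eq_0:
  assumes "A \<subseteq> E" "B \<subseteq> E" "A \<noteq> B"
  shows "expect (\<lambda>x. chi A x * chi B x) = 0"
proof -
  have *: "expect (\<lambda>x. chi A x * chi B x) = 0"
    if AB: "A \<subseteq> E" "B \<subseteq> E" and a: "a \<in> A" "a \<notin> B" for A B a
  proof -
    have [simp]: "finite A" using AB(1) finite_E by (rule finite_subset)
    have eq: "(\<lambda>x. chi A x * chi B x) = (\<lambda>x. noise a x *\<^sub>R (chi (A - {a}) x * chi B x))"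
      using a by (simp add: chi_def prod.remove[of A a] mult_ac)
    show ?thesis
      unfolding eq
    proof (rule expect_noise_scaleR)
      show "a \<in> E" using a AB by blast
      show "chi (A - {a}) (x(a := v)) * chi B (x(a := v)) = chi (A - {a}) x * chi B x" for x v
        unfolding chi_def using a
        by (intro arg_cong2[where f = "(*)"] prod.cong) (auto simp: noise_def)
    qed
  qed
  from assms(3) consider a where "a \<in> A" "a \<notin> B" | a where "a \<in> B" "a \<notin> A" by blast
  thus ?thesis
  proof cases
    case 1
    thus ?thesis by (rule *[OF assms(1,2)])
  next
    case 2
    have "expect (\<lambda>x. chi B x * chi A x) = 0" by (rule *[OF assms(2,1) 2])
    thus ?thesis by (simp add: mult.commute)
  qed
qed

text \<open>Orthogonality leaves only the pairs \<open>i\<close>, \<open>j\<close> with \<open>A i = A j\<close>, and the bound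
  \<open>2 * c i * c j \<le> (c i)\<^sup>2 + (c j)\<^sup>2\<close> charges such a pair to its two indices. The multiplicity \<open>m\<close> is there
  because the sums to be estimated run over tuples of vertices, and one edge set comes from several
  tuples.\<close>

lemma second_moment_le:
  assumes I: "finite I" and A: "\<And>i. i \<in> I \<Longrightarrow> A i \<subseteq> E"
    and m: "\<And>i. i \<in> I \<Longrightarrow> card {j \<in> I. A j = A i} \<le> m"
  shows "expect (\<lambda>x. (\<Sum>i\<in>I. c i * chi (A i) x)\<^sup>2) \<le> real m * (\<Sum>i\<in>I. (c i)\<^sup>2)"
proof -
  have "expect (\<lambda>x. (\<Sum>i\<in>I. c i * chi (A i) x)\<^sup>2) =
      (\<Sum>i\<in>I. \<Sum>j\<in>I. c i * c j * expect (\<lambda>x. chi (A i) x * chi (A j) x))"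
  proof -
    have "(\<Sum>i\<in>I. c i * chi (A i) x)\<^sup>2 =
        (\<Sum>i\<in>I. \<Sum>j\<in>I. (c i * c j) * (chi (A i) x * chi (A j) x))" for x
      by (simp add: power2_eq_square sum_product mult_ac)
    thus ?thesis by simp
  qed
  also have "\<dots> \<le> (\<Sum>i\<in>I. \<Sum>j\<in>I. of_bool (A j = A i) * (((c i)\<^sup>2 + (c j)\<^sup>2) / 2))"
  proof (intro sum_mono)
    fix i j assume ij: "i \<in> I" "j \<in> I"
    show "c i * c j * expect (\<lambda>x. chi (A i) x * chi (A j) x)
        \<le> of_bool (A j = A i) * (((c i)\<^sup>2 + (c j)\<^sup>2) / 2)"
    proof (cases "A j = A i")
      case True
      have "\<bar>expect (\<lambda>x. chi (A i) x * chi (A j) x)\<bar> \<le> expect (\<lambda>x. \<bar>chi (A i) x * chi (A j) x\<bar>)"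
        using expect_norm_le[of "\<lambda>x. chi (A i) x * chi (A j) x"] by simp
      also have "\<dots> \<le> expect (\<lambda>x. 1)"
        by (intro expect_mono) (simp add: abs_mult mult_le_one abs_chi_le_1)
      finally have "\<bar>c i * c j\<bar> * \<bar>expect (\<lambda>x. chi (A i) x * chi (A j) x)\<bar> \<le> \<bar>c i * c j\<bar> * 1"
        by (intro mult_left_mono) auto
      moreover have "\<bar>c i * c j\<bar> \<le> ((c i)\<^sup>2 + (c j)\<^sup>2) / 2"
        using sum_squares_bound[of "\<bar>c i\<bar>" "\<bar>c j\<bar>"] by (simp add: abs_mult)
      moreover have "c i * c j * expect (\<lambda>x. chi (A i) x * chi (A j) x) \<le>
          \<bar>c i * c j\<bar> * \<bar>expect (\<lambda>x. chi (A i) x * chi (A j) x)\<bar>"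
        unfolding abs_mult[symmetric] by (rule abs_ge_self)
      ultimately have "c i * c j * expect (\<lambda>x. chi (A i) x * chi (A j) x) \<le>
          ((c i)\<^sup>2 + (c j)\<^sup>2) / 2" by linarith
      thus ?thesis using True by simp
    qed (use expect_chi_chi_eq_0[of "A i" "A j"] A ij in auto)
  qed
  also have "\<dots> = (\<Sum>i\<in>I. \<Sum>j\<in>I. of_bool (A j = A i) * (c i)\<^sup>2 / 2) +
                  (\<Sum>i\<in>I. \<Sum>j\<in>I. of_bool (A i = A j) * (c j)\<^sup>2 / 2)"
    by (simp add: sum.distrib[symmetric] add_divide_distrib distrib_left eq_commute)
  also have "(\<Sum>i\<in>I. \<Sum>j\<in>I. of_bool (A i = A j) * (c j)\<^sup>2 / 2) =
             (\<Sum>i\<in>I. \<Sum>j\<in>I. of_bool (A j = A i) * (c i)\<^sup>2 / 2)"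
    by (rule sum.swap)
  also have "(\<Sum>i\<in>I. \<Sum>j\<in>I. of_bool (A j = A i) * (c i)\<^sup>2 / 2) +
             (\<Sum>i\<in>I. \<Sum>j\<in>I. of_bool (A j = A i) * (c i)\<^sup>2 / 2) =
             (\<Sum>i\<in>I. real (card {j \<in> I. A j = A i}) * (c i)\<^sup>2)"
    using I by (simp add: sum_divide_distrib[symmetric] sum_distrib_right[symmetric] Int_def conj_commute)
  also have "\<dots> \<le> (\<Sum>i\<in>I. real m * (c i)\<^sup>2)"
    using m by (intro sum_mono mult_right_mono) auto
  finally show ?thesis by (simp add: sum_distrib_left)
qed

lemma expect_abs_le_sqrt:
  fixes f :: "_ \<Rightarrow> real"
  assumes "expect (\<lambda>x. (f x)\<^sup>2) \<le> c"
  shows "expect (\<lambda>x. \<bar>f x\<bar>) \<le> sqrt c"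
proof -
  have "0 \<le> measure_pmf.variance P (\<lambda>x. \<bar>f x\<bar>)"
    by (rule Bochner_Integration.integral_nonneg) auto
  also have "\<dots> = expect (\<lambda>x. (f x)\<^sup>2) - (expect (\<lambda>x. \<bar>f x\<bar>))\<^sup>2"
    by (subst measure_pmf.variance_eq) auto
  finally show ?thesis using assms by (intro real_le_rsqrt) simp
qed

lemma expect_sum_noise_squared_le:
  assumes "B \<subseteq> E"
  shows "expect (\<lambda>x. (\<Sum>b\<in>B. noise b x)\<^sup>2) \<le> card B"
proof -
  have "finite B" using assms finite_E by (rule finite_subset)
  moreover have "card {j \<in> B. {j} = {i}} \<le> 1" for i
    using card_mono[of "{i}" "{j \<in> B. {j} = {i}}"] by auto
  moreover have "{b} \<subseteq> E" if "b \<in> B" for b using that assms by blast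
  ultimately show ?thesis
    using second_moment_le[of B "\<lambda>b. {b}" 1 "\<lambda>_. 1"] by simp
qed

lemma card_doubleton_fibre_le: "card {j \<in> I. {fst j, snd j} = {fst i, snd i}} \<le> 2"
proof -
  have "card {j \<in> I. {fst j, snd j} = {fst i, snd i}} \<le> card {i, (snd i, fst i)}"
    by (intro card_mono) (auto simp: doubleton_eq_iff prod_eq_iff)
  also have "\<dots> \<le> 2"
    by (simp add: card_insert_if)
  finally show ?thesis .
qed

lemma expect_sum_pairs_squared_le:
  assumes "I \<subseteq> E \<times> E"
  shows "expect (\<lambda>x. (\<Sum>i\<in>I. c i * chi {fst i, snd i} x)\<^sup>2) \<le> 2 * (\<Sum>i\<in>I. (c i)\<^sup>2)"
proof -
  have "finite I" using assms finite_E by (meson finite_SigmaI finite_subset)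
  moreover have "{fst i, snd i} \<subseteq> E" if "i \<in> I" for i using that assms by auto
  ultimately show ?thesis
    using second_moment_le[of I "\<lambda>i. {fst i, snd i}" 2 c] card_doubleton_fibre_le[of I] by simp
qed

lemma sum_noise_squared:
  assumes "finite B"
  shows "(\<Sum>b\<in>B. noise b x)\<^sup>2 = card B * var + (1 - 2 * p) * (\<Sum>b\<in>B. noise b x)
           + (\<Sum>i\<in>{i\<in>B \<times> B. fst i \<noteq> snd i}. chi {fst i, snd i} x)"
proof -
  have "(\<Sum>b\<in>B. noise b x)\<^sup>2 = (\<Sum>i\<in>B \<times> B. noise (fst i) x * noise (snd i) x)"
    by (simp add: power2_eq_square sum_product sum.cartesian_product case_prod_beta)
  also have "B \<times> B = (\<lambda>b. (b, b)) ` B \<union> {i\<in>B \<times> B. fst i \<noteq> snd i}"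
    by auto
  also have "(\<Sum>i\<in>\<dots>. noise (fst i) x * noise (snd i) x) =
     (\<Sum>i\<in>(\<lambda>b. (b, b)) ` B. noise (fst i) x * noise (snd i) x) +
     (\<Sum>i\<in>{i\<in>B \<times> B. fst i \<noteq> snd i}. noise (fst i) x * noise (snd i) x)"
    by (rule sum.union_disjoint) (use assms in auto)
  also have "(\<Sum>i\<in>(\<lambda>b. (b, b)) ` B. noise (fst i) x * noise (snd i) x) = (\<Sum>b\<in>B. (noise b x)\<^sup>2)"
    by (subst sum.reindex) (auto simp: inj_on_def power2_eq_square)
  also have "\<dots> = card B * var + (1 - 2 * p) * (\<Sum>b\<in>B. noise b x)"
    by (simp add: noise_squared sum.distrib sum_distrib_left)
  also have "(\<Sum>i\<in>{i\<in>B \<times> B. fst i \<noteq> snd i}. noise (fst i) x * noise (snd i) x) =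
             (\<Sum>i\<in>{i\<in>B \<times> B. fst i \<noteq> snd i}. chi {fst i, snd i} x)"
    by (intro sum.cong) (auto simp: chi_doubleton)
  finally show ?thesis .
qed

lemma var_sq_le_1: "var\<^sup>2 \<le> 1"
  using var_pos var_le_1 by (simp add: power_le_one)

lemma bias_sq_le_1: "(1 - 2 * p)\<^sup>2 \<le> 1"
  using p_pos p_less_1 by (intro power2_le_iff_abs_le[THEN iffD2, of 1, simplified]) auto

text \<open>By \<open>sum_noise_squared\<close> the square of the sum is a constant plus a linear and an
  off-diagonal part. Squaring once more, the fourth moment is bounded by the second moments of these
  three parts, each of order at most \<open>(card B)\<^sup>2\<close>.\<close>

lemma expect_sum_noise_pow4_le:
  assumes B: "B \<subseteq> E" "B \<noteq> {}"
  shows "expect (\<lambda>x. (\<Sum>b\<in>B. noise b x) ^ 4) \<le> 12 * (card B)\<^sup>2"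
proof -
  have fin: "finite B" using B(1) finite_E by (rule finite_subset)
  define d where "d = real (card B)"
  have d: "1 \<le> d" using B fin by (simp add: d_def Suc_le_eq card_gt_0_iff)
  define I where "I = {i\<in>B \<times> B. fst i \<noteq> snd i}"
  define l q where "l = (\<lambda>x. \<Sum>b\<in>B. noise b x)" and "q = (\<lambda>x. \<Sum>i\<in>I. 1 * chi {fst i, snd i} x)"
  have "l x ^ 4 \<le> 3 * (d\<^sup>2 + (l x)\<^sup>2 + (q x)\<^sup>2)" for x
  proof -
    have "l x ^ 4 = ((l x)\<^sup>2)\<^sup>2" by simp
    also have "(l x)\<^sup>2 = d * var + (1 - 2 * p) * l x + q x"
      unfolding l_def q_def I_def d_def by (subst sum_noise_squared[OF fin]) simp
    also have "(\<dots>)\<^sup>2 \<le> 3 * ((d * var)\<^sup>2 + ((1 - 2 * p) * l x)\<^sup>2 + (q x)\<^sup>2)"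
      by (rule square_sum3_le)
    also have "\<dots> \<le> 3 * (d\<^sup>2 + (l x)\<^sup>2 + (q x)\<^sup>2)"
      unfolding power_mult_distrib
      using mult_left_mono[OF var_sq_le_1, of "d\<^sup>2"] mult_right_mono[OF bias_sq_le_1, of "(l x)\<^sup>2"] by simp
    finally show ?thesis .
  qed
  hence "expect (\<lambda>x. l x ^ 4) \<le> expect (\<lambda>x. 3 * (d\<^sup>2 + (l x)\<^sup>2 + (q x)\<^sup>2))"
    by (rule expect_mono)
  also have "\<dots> = 3 * (d\<^sup>2 + expect (\<lambda>x. (l x)\<^sup>2) + expect (\<lambda>x. (q x)\<^sup>2))"
    by simp
  also have "\<dots> \<le> 3 * (d\<^sup>2 + d + 2 * d\<^sup>2)"
  proof -
    have "expect (\<lambda>x. (l x)\<^sup>2) \<le> d"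
      unfolding l_def d_def by (rule expect_sum_noise_squared_le[OF B(1)])
    moreover have "expect (\<lambda>x. (q x)\<^sup>2) \<le> 2 * (\<Sum>i\<in>I. 1\<^sup>2)"
      unfolding q_def by (rule expect_sum_pairs_squared_le) (use B in \<open>auto simp: I_def\<close>)
    moreover have "real (card I) \<le> d\<^sup>2"
    proof -
      have "card I \<le> card (B \<times> B)" unfolding I_def using fin by (intro card_mono) auto
      thus ?thesis by (simp add: d_def power2_eq_square card_cartesian_product flip: of_nat_mult)
    qed
    ultimately show ?thesis by simp
  qed
  also have "\<dots> \<le> 12 * d\<^sup>2"
    using mult_left_mono[OF d, of d] d by (simp add: power2_eq_square)
  finally show ?thesis by (simp add: l_def d_def)
qed

text \<open>Interpolation between the second and the fourth moment, by the inequality of arithmetic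
  and geometric means balanced at the typical size \<open>sqrt (card B)\<close> of the sum.\<close>

lemma expect_sum_noise_abs_cubed_le:
  assumes B: "B \<subseteq> E" "B \<noteq> {}"
  shows "expect (\<lambda>x. \<bar>\<Sum>b\<in>B. noise b x\<bar> ^ 3) \<le> 7 * (card B * sqrt (card B))"
proof -
  have fin: "finite B" using B(1) finite_E by (rule finite_subset)
  define d r where "d = real (card B)" and "r = sqrt (card B)"
  have d: "1 \<le> d" using B fin by (simp add: d_def Suc_le_eq card_gt_0_iff)
  have r: "0 < r" "r * r = d" using d by (auto simp: r_def d_def)
  define l where "l = (\<lambda>x. \<Sum>b\<in>B. noise b x)"
  have "\<bar>l x\<bar> ^ 3 \<le> r / 2 * (l x)\<^sup>2 + 1 / (2 * r) * l x ^ 4" for x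
  proof -
    have "2 * r * \<bar>l x\<bar> \<le> r\<^sup>2 + (l x)\<^sup>2"
      using sum_squares_bound[of r "\<bar>l x\<bar>"] by simp
    hence "(2 * r * \<bar>l x\<bar>) / (2 * r) \<le> (r\<^sup>2 + (l x)\<^sup>2) / (2 * r)"
      using r(1) by (intro divide_right_mono) auto
    also have "(2 * r * \<bar>l x\<bar>) / (2 * r) = \<bar>l x\<bar>"
      using r(1) by simp
    also have "(r\<^sup>2 + (l x)\<^sup>2) / (2 * r) = (r + (l x)\<^sup>2 / r) / 2"
      using r(1) by (simp add: power2_eq_square add_divide_distrib)
    finally have "\<bar>l x\<bar> \<le> (r + (l x)\<^sup>2 / r) / 2" .
    hence "(l x)\<^sup>2 * \<bar>l x\<bar> \<le> (l x)\<^sup>2 * ((r + (l x)\<^sup>2 / r) / 2)"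
      by (intro mult_left_mono) auto
    moreover have "\<bar>l x\<bar> ^ 3 = (l x)\<^sup>2 * \<bar>l x\<bar>"
      by (metis power2_abs power2_eq_square power3_eq_cube)
    moreover have "(l x)\<^sup>2 * ((r + (l x)\<^sup>2 / r) / 2) = r / 2 * (l x)\<^sup>2 + 1 / (2 * r) * l x ^ 4"
      by (simp add: power4_eq_xxxx power2_eq_square add_divide_distrib distrib_left mult_ac)
    ultimately show ?thesis by simp
  qed
  hence "expect (\<lambda>x. \<bar>l x\<bar> ^ 3) \<le> expect (\<lambda>x. r / 2 * (l x)\<^sup>2 + 1 / (2 * r) * l x ^ 4)"
    by (rule expect_mono)
  also have "\<dots> = r / 2 * expect (\<lambda>x. (l x)\<^sup>2) + 1 / (2 * r) * expect (\<lambda>x. l x ^ 4)"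
    by simp
  also have "\<dots> \<le> r / 2 * d + 1 / (2 * r) * (12 * d\<^sup>2)"
    using expect_sum_noise_squared_le[OF B(1)] expect_sum_noise_pow4_le[OF B] r
    by (intro add_mono mult_left_mono) (auto simp: l_def d_def)
  also have "1 / (2 * r) * (12 * d\<^sup>2) = 6 * (d * r)"
    using r(1) by (simp add: r(2)[symmetric] power2_eq_square)
  also have "r / 2 * d + 6 * (d * r) \<le> 7 * (d * r)"
    using r d by simp
  finally show ?thesis by (simp add: l_def d_def r_def)
qed

end

section \<open>Quadratic forms on regular graphs\<close>

locale regular_quadratic_form = bernoulli_family E p for E :: "'e set" and p +
  fixes adj :: "'e \<Rightarrow> 'e \<Rightarrow> bool" and d :: nat
  assumes adj_sym: "adj a b \<Longrightarrow> adj b a" and adj_irrefl: "\<not> adj a a"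
    and regular: "a \<in> E \<Longrightarrow> card {b \<in> E. adj a b} = d"
    and d_pos: "0 < d" and E_nonempty: "E \<noteq> {}"
begin

definition nbrs :: "'e \<Rightarrow> 'e set" where
  "nbrs a = {b \<in> E. adj a b}"

text \<open>The partial derivative of the quadratic form \<open>S\<close> below with respect to the noise at \<open>a\<close>.\<close>

definition L :: "'e \<Rightarrow> ('e \<Rightarrow> bool) \<Rightarrow> real" where
  "L a x = (\<Sum>b\<in>nbrs a. noise b x)"

text \<open>The factor \<open>1 / 2\<close> makes each unordered pair of neighbours count once.\<close>

definition S :: "('e \<Rightarrow> bool) \<Rightarrow> real" where
  "S x = (\<Sum>a\<in>E. noise a x * L a x) / 2"

definition S_without :: "'e \<Rightarrow> ('e \<Rightarrow> bool) \<Rightarrow> real" where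
  "S_without a x = (\<Sum>e\<in>E - {a}. noise e x * (\<Sum>f\<in>nbrs e - {a}. noise f x)) / 2"

lemma finite_nbrs [simp]: "finite (nbrs a)" and nbrs_subset: "nbrs a \<subseteq> E"
  using finite_E by (auto simp: nbrs_def)

lemma card_nbrs: "a \<in> E \<Longrightarrow> card (nbrs a) = d"
  by (simp add: nbrs_def regular)

lemma nbrs_nonempty: "a \<in> E \<Longrightarrow> nbrs a \<noteq> {}"
  using card_nbrs d_pos by fastforce

lemma L_fun_upd: "L a (x(a := v)) = L a x"
  unfolding L_def by (intro sum.cong noise_fun_upd_other) (auto simp: nbrs_def adj_irrefl)

lemma S_without_fun_upd: "S_without a (x(a := v)) = S_without a x"
  unfolding S_without_def by (simp add: noise_fun_upd_other cong: sum.cong_simp)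

lemma sum_nbrs_eq: "(\<Sum>b\<in>nbrs a. g b) = (\<Sum>b\<in>E. of_bool (adj a b) * g b)" for g :: "'e \<Rightarrow> real"
  unfolding nbrs_def by (rule sum.mono_neutral_cong_left) (use finite_E in auto)

lemma adj_commute: "adj a b \<longleftrightarrow> adj b a"
  using adj_sym by blast

lemma S_split:
  assumes a: "a \<in> E"
  shows "S x = S_without a x + noise a x * L a x"
proof -
  have L: "L e x = of_bool (adj e a) * noise a x + (\<Sum>f\<in>nbrs e - {a}. noise f x)" for e
  proof (cases "adj e a")
    case True
    thus ?thesis
      using a by (simp add: L_def nbrs_def sum.remove[of _ a] finite_E)
  next
    case False
    hence "nbrs e - {a} = nbrs e" by (auto simp: nbrs_def)
    thus ?thesis using False by (simp add: L_def)
  qed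
  have "(\<Sum>e\<in>E - {a}. noise e x * L e x) =
      noise a x * (\<Sum>e\<in>E - {a}. of_bool (adj a e) * noise e x) + 2 * S_without a x"
    unfolding S_without_def by (simp add: L distrib_left sum.distrib sum_distrib_left mult_ac adj_commute)
  also have "(\<Sum>e\<in>E - {a}. of_bool (adj a e) * noise e x) = L a x"
    unfolding L_def nbrs_def
    by (rule sum.mono_neutral_cong_right) (use finite_E adj_irrefl in auto)
  finally show ?thesis
    using a finite_E by (simp add: S_def sum.remove[of E a] field_simps)
qed

text \<open>The mean of each \<open>(L a)\<^sup>2\<close> is \<open>d * var\<close>, so this is the deviation of the sum of the squares
  from its mean.\<close>

definition Z :: "('e \<Rightarrow> bool) \<Rightarrow> real" where
  "Z x = (\<Sum>a\<in>E. (L a x)\<^sup>2) - card E * d * var"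

text \<open>In the sum of the squares of the \<open>L a\<close>, the linear part has the coefficient
  \<open>(1 - 2 * p) * d\<close> everywhere, by regularity, and the off-diagonal pair \<open>(b, c)\<close> has as coefficient
  the number \<open>K (b, c)\<close> of common neighbours. Bounding one factor of \<open>K\<^sup>2\<close> by \<open>d\<close> and summing the other,
  which counts pairs of neighbours of a common point, gives \<open>card E * d ^ 3\<close>. Compared with
  the square of \<open>card E * d * var\<close>, this is of relative order \<open>d / card E\<close>.\<close>

lemma expect_Z_squared_le: "expect (\<lambda>x. (Z x)\<^sup>2) \<le> 6 * card E * real d ^ 3"
proof -
  define I where "I = {i\<in>E \<times> E. fst i \<noteq> snd i}"
  define K where "K = (\<lambda>i. \<Sum>a\<in>E. of_bool (adj a (fst i)) * of_bool (adj a (snd i)) :: real)"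
  define l q where "l = (\<lambda>x. \<Sum>b\<in>E. noise b x)" and "q = (\<lambda>x. \<Sum>i\<in>I. K i * chi {fst i, snd i} x)"
  have finI: "finite I" using finite_E by (simp add: I_def)
  have deg: "(\<Sum>a\<in>E. of_bool (adj a b)) = real d" "(\<Sum>a\<in>E. of_bool (adj b a)) = real d" if "b \<in> E" for b
    using regular[OF that] finite_E by (simp_all add: adj_commute[of _ b] Int_def conj_commute)
  have Z: "Z x = (1 - 2 * p) * d * l x + q x" for x
  proof -
    have "(L a x)\<^sup>2 = d * var + (1 - 2 * p) * L a x +
        (\<Sum>i\<in>I. of_bool (adj a (fst i)) * of_bool (adj a (snd i)) * chi {fst i, snd i} x)"
      if a: "a \<in> E" for a
    proof -
      have "(\<Sum>i\<in>{i \<in> nbrs a \<times> nbrs a. fst i \<noteq> snd i}. chi {fst i, snd i} x) =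
        (\<Sum>i\<in>I. of_bool (adj a (fst i)) * of_bool (adj a (snd i)) * chi {fst i, snd i} x)"
        by (rule sum.mono_neutral_cong_left) (use finI in \<open>auto simp: I_def nbrs_def\<close>)
      thus ?thesis
        unfolding L_def using sum_noise_squared[of "nbrs a" x] by (simp add: card_nbrs[OF a])
    qed
    hence "(\<Sum>a\<in>E. (L a x)\<^sup>2) = (\<Sum>a\<in>E. d * var + (1 - 2 * p) * L a x +
        (\<Sum>i\<in>I. of_bool (adj a (fst i)) * of_bool (adj a (snd i)) * chi {fst i, snd i} x))"
      by (intro sum.cong) auto
    also have "\<dots> = card E * d * var + (1 - 2 * p) * (\<Sum>a\<in>E. L a x) +
        (\<Sum>a\<in>E. \<Sum>i\<in>I. of_bool (adj a (fst i)) * of_bool (adj a (snd i)) * chi {fst i, snd i} x)"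
      by (simp add: sum.distrib sum_distrib_left)
    also have "(\<Sum>a\<in>E. \<Sum>i\<in>I. of_bool (adj a (fst i)) * of_bool (adj a (snd i)) * chi {fst i, snd i} x) = q x"
      unfolding q_def K_def sum_distrib_right by (rule sum.swap)
    also have "(\<Sum>a\<in>E. L a x) = (\<Sum>b\<in>E. (\<Sum>a\<in>E. of_bool (adj a b)) * noise b x)"
      unfolding L_def sum_nbrs_eq sum_distrib_right by (rule sum.swap)
    also have "\<dots> = d * l x"
      by (simp add: deg l_def sum_distrib_left)
    finally show ?thesis by (simp add: Z_def)
  qed
  have K_sq: "(\<Sum>i\<in>I. (K i)\<^sup>2) \<le> card E * real d ^ 3"
  proof -
    have K_nonneg: "0 \<le> K i" for i unfolding K_def by (intro sum_nonneg) auto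
    have "(\<Sum>i\<in>I. (K i)\<^sup>2) \<le> (\<Sum>i\<in>E \<times> E. (K i)\<^sup>2)"
      by (rule sum_mono2) (use finite_E in \<open>auto simp: I_def\<close>)
    also have "\<dots> \<le> (\<Sum>i\<in>E \<times> E. d * K i)"
    proof (intro sum_mono)
      fix i assume i: "i \<in> E \<times> E"
      have "K i \<le> (\<Sum>a\<in>E. of_bool (adj a (fst i)))"
        unfolding K_def by (intro sum_mono) auto
      hence "K i \<le> d" using deg(1)[of "fst i"] i by auto
      thus "(K i)\<^sup>2 \<le> d * K i" 
        using mult_right_mono[OF _ K_nonneg[of i]] by (simp add: power2_eq_square)
    qed
    also have "\<dots> = d * (\<Sum>i\<in>E \<times> E. K i)" by (simp add: sum_distrib_left)
    also have "(\<Sum>i\<in>E \<times> E. K i) =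
        (\<Sum>a\<in>E. \<Sum>i\<in>E \<times> E. of_bool (adj a (fst i)) * of_bool (adj a (snd i)))"
      unfolding K_def by (rule sum.swap)
    also have "\<dots> = (\<Sum>a\<in>E. (\<Sum>b\<in>E. of_bool (adj a b)) * (\<Sum>c\<in>E. of_bool (adj a c)))"
      by (simp only: sum_product sum.cartesian_product) (auto intro!: sum.cong)
    also have "\<dots> = card E * (real d * real d)"
      by (simp add: deg)
    finally show ?thesis by (simp add: power3_eq_cube mult_ac)
  qed
  have "(Z x)\<^sup>2 \<le> 2 * (d\<^sup>2 * (l x)\<^sup>2) + 2 * (q x)\<^sup>2" for x
  proof -
    have "(Z x)\<^sup>2 \<le> 2 * ((1 - 2 * p) * d * l x)\<^sup>2 + 2 * (q x)\<^sup>2"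
      unfolding Z using sum_squares_bound[of "(1 - 2 * p) * d * l x" "q x"] by (simp add: power2_sum)
    also have "((1 - 2 * p) * d * l x)\<^sup>2 \<le> d\<^sup>2 * (l x)\<^sup>2"
      using mult_right_mono[OF bias_sq_le_1, of "d\<^sup>2 * (l x)\<^sup>2"] by (simp add: power_mult_distrib mult_ac)
    finally show ?thesis by simp
  qed
  hence "expect (\<lambda>x. (Z x)\<^sup>2) \<le> expect (\<lambda>x. 2 * (d\<^sup>2 * (l x)\<^sup>2) + 2 * (q x)\<^sup>2)"
    by (rule expect_mono)
  also have "\<dots> = 2 * (d\<^sup>2 * expect (\<lambda>x. (l x)\<^sup>2)) + 2 * expect (\<lambda>x. (q x)\<^sup>2)"
    by simp
  also have "\<dots> \<le> 2 * (d\<^sup>2 * card E) + 2 * (2 * (\<Sum>i\<in>I. (K i)\<^sup>2))"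
  proof -
    have A: "expect (\<lambda>x. (l x)\<^sup>2) \<le> card E"
      unfolding l_def by (rule expect_sum_noise_squared_le) simp
    have B: "expect (\<lambda>x. (q x)\<^sup>2) \<le> 2 * (\<Sum>i\<in>I. (K i)\<^sup>2)"
      unfolding q_def by (rule expect_sum_pairs_squared_le) (auto simp: I_def)
    show ?thesis using mult_left_mono[OF A, of "(real d)\<^sup>2"] B by simp
  qed
  also have "\<dots> \<le> 2 * (real d ^ 3 * card E) + 2 * (2 * (card E * real d ^ 3))"
  proof -
    have "real d ^ 2 \<le> real d ^ 3" using d_pos by (intro power_increasing) auto
    from mult_right_mono[OF this, of "real (card E)"] show ?thesis using K_sq by (simp add: mult_ac)
  qed
  finally show ?thesis by (simp add: mult_ac)
qed

text \<open>Insert \<open>S = S_without a + noise a * L a\<close> and expand \<open>iexp (u * noise a * L a)\<close> to first order.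
  The term of order zero vanishes, as the noise at \<open>a\<close> has mean zero given the rest. In the term of
  order one, the square of the noise is \<open>var + (1 - 2 * p) * noise a\<close>, and the second summand vanishes for the
  same reason. Putting \<open>S\<close> back in place of \<open>S_without a\<close> costs an error of the same third order as
  the remainder of the expansion.\<close>

lemma edge_estimate:
  fixes u :: real
  assumes a: "a \<in> E"
  shows "norm (expect (\<lambda>x. complex_of_real (noise a x * L a x) * iexp (u * S x)) -
      \<i> * u * var * expect (\<lambda>x. complex_of_real ((L a x)\<^sup>2) * iexp (u * S x)))
      \<le> 3 / 2 * u\<^sup>2 * expect (\<lambda>x. \<bar>L a x\<bar> ^ 3)"
proof -
  define w y where "w = (\<lambda>x. iexp (u * S_without a x))" and "y = (\<lambda>x. u * (noise a x * L a x))"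
  \<comment> \<open>The terms that vanish in expectation: k = 1 has order zero in u, and k = 2 has order one.\<close>
  define f where "f = (\<lambda>k x. noise a x *\<^sub>R (complex_of_real (L a x ^ k) * w x))"
  define r where "r = (\<lambda>x. complex_of_real (noise a x * L a x) * w x * (iexp (y x) - 1 - \<i> * y x)
      - \<i> * u * var * complex_of_real ((L a x)\<^sup>2) * w x * (iexp (y x) - 1))"
  have f: "expect (f k) = 0" for k
    unfolding f_def using a
    by (intro expect_noise_scaleR) (simp_all add: w_def L_fun_upd S_without_fun_upd)
  have S: "iexp (u * S x) = w x * iexp (y x)" for x
    by (simp add: S_split[OF a] w_def y_def exp_add[symmetric] algebra_simps)
  have eq: "complex_of_real (noise a x * L a x) * iexp (u * S x) -
      \<i> * u * var * (complex_of_real ((L a x)\<^sup>2) * iexp (u * S x)) =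
      f 1 x + \<i> * u * (1 - 2 * p) * f 2 x + r x" for x
  proof -
    have sq: "complex_of_real (noise a x) * complex_of_real (noise a x) =
        var + (1 - 2 * p) * complex_of_real (noise a x)"
      using arg_cong[OF noise_squared[of a x], of complex_of_real] by (simp add: power2_eq_square)
    have "f 1 x + \<i> * u * (1 - 2 * p) * f 2 x + r x -
        (complex_of_real (noise a x * L a x) * iexp (u * S x) -
         \<i> * u * var * (complex_of_real ((L a x)\<^sup>2) * iexp (u * S x))) =
       \<i> * u * complex_of_real ((L a x)\<^sup>2) * w x * ((var + (1 - 2 * p) * complex_of_real (noise a x)) -
          complex_of_real (noise a x) * complex_of_real (noise a x))"
      unfolding S f_def r_def
      by (simp add: scaleR_conv_of_real y_def power2_eq_square algebra_simps)
    thus ?thesis by (simp add: sq)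
  qed
  have r: "norm (r x) \<le> 3 / 2 * u\<^sup>2 * \<bar>L a x\<bar> ^ 3" for x
  proof -
    have y: "\<bar>y x\<bar> \<le> \<bar>u\<bar> * \<bar>L a x\<bar>"
      using mult_left_mono[OF abs_noise_le_1[of a x], of "\<bar>u\<bar> * \<bar>L a x\<bar>"]
      by (simp add: y_def abs_mult mult_ac)
    have w: "norm (w x) = 1" by (simp add: w_def)
    have "norm (complex_of_real (noise a x * L a x) * w x * (iexp (y x) - 1 - \<i> * y x)) =
        \<bar>noise a x\<bar> * \<bar>L a x\<bar> * norm (iexp (y x) - 1 - \<i> * y x)"
      by (simp add: norm_mult w abs_mult)
    also have "\<dots> \<le> 1 * \<bar>L a x\<bar> * ((\<bar>u\<bar> * \<bar>L a x\<bar>)\<^sup>2 / 2)"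
    proof (intro mult_mono order_trans[OF norm_iexp_minus_linear_le] abs_noise_le_1)
      show "(y x)\<^sup>2 / 2 \<le> (\<bar>u\<bar> * \<bar>L a x\<bar>)\<^sup>2 / 2"
        using power_mono[OF y abs_ge_zero, of 2] by simp
    qed auto
    finally have 1: "norm (complex_of_real (noise a x * L a x) * w x * (iexp (y x) - 1 - \<i> * y x))
        \<le> u\<^sup>2 * \<bar>L a x\<bar> ^ 3 / 2"
      by (simp add: power_mult_distrib power3_eq_cube power2_eq_square mult_ac)
    have "norm (\<i> * u * var * complex_of_real ((L a x)\<^sup>2) * w x * (iexp (y x) - 1)) =
        \<bar>u\<bar> * var * \<bar>L a x\<bar>\<^sup>2 * norm (iexp (y x) - 1)"
      using var_pos by (simp add: norm_mult w norm_power)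
    also have "\<dots> \<le> \<bar>u\<bar> * 1 * \<bar>L a x\<bar>\<^sup>2 * (\<bar>u\<bar> * \<bar>L a x\<bar>)"
      using var_pos
      by (intro mult_mono order_trans[OF norm_iexp_minus_1_le] y var_le_1) auto
    finally have 2: "norm (\<i> * u * var * complex_of_real ((L a x)\<^sup>2) * w x * (iexp (y x) - 1))
        \<le> u\<^sup>2 * \<bar>L a x\<bar> ^ 3"
      by (simp add: power_mult_distrib power3_eq_cube power2_eq_square mult_ac)
    show ?thesis
      unfolding r_def using norm_triangle_ineq4 1 2 by (rule order_trans[OF _ order_trans[OF add_mono]]) simp
  qed
  have "expect (\<lambda>x. complex_of_real (noise a x * L a x) * iexp (u * S x)) -
      \<i> * u * var * expect (\<lambda>x. complex_of_real ((L a x)\<^sup>2) * iexp (u * S x)) =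
      expect (\<lambda>x. complex_of_real (noise a x * L a x) * iexp (u * S x) -
        \<i> * u * var * (complex_of_real ((L a x)\<^sup>2) * iexp (u * S x)))"
    by simp
  also have "\<dots> = expect (\<lambda>x. f 1 x + \<i> * u * (1 - 2 * p) * f 2 x + r x)"
    unfolding eq ..
  also have "\<dots> = expect r"
    by (simp add: f)
  also have "norm \<dots> \<le> expect (\<lambda>x. norm (r x))"
    by (rule expect_norm_le)
  also have "\<dots> \<le> expect (\<lambda>x. 3 / 2 * u\<^sup>2 * \<bar>L a x\<bar> ^ 3)"
    by (rule expect_mono[OF r])
  finally show ?thesis by simp
qed

text \<open>The Stein identity of a normal law of variance \<open>var\<^sup>2 * card E * d / 2\<close>, with errors: the sum
  of \<open>edge_estimate\<close> over \<open>a\<close>, in which the sum of the squares of the \<open>L a\<close> is replaced by its mean at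
  the cost of \<open>Z\<close>.\<close>

lemma stein_estimate:
  fixes u :: real
  defines "\<phi> \<equiv> expect (\<lambda>x. iexp (u * S x))"
  shows "norm (expect (\<lambda>x. complex_of_real (S x) * iexp (u * S x)) -
      \<i> * u * (var\<^sup>2 * card E * d / 2) * \<phi>)
      \<le> \<bar>u\<bar> / 2 * sqrt (6 * card E * real d ^ 3) + 6 * u\<^sup>2 * card E * (d * sqrt d)"
proof -
  define T where "T = (\<lambda>a. expect (\<lambda>x. complex_of_real (noise a x * L a x) * iexp (u * S x)))"
  define Q where "Q = (\<lambda>a. expect (\<lambda>x. complex_of_real ((L a x)\<^sup>2) * iexp (u * S x)))"
  define z where "z = expect (\<lambda>x. complex_of_real (Z x) * iexp (u * S x))"
  have T: "expect (\<lambda>x. complex_of_real (S x) * iexp (u * S x)) = (\<Sum>a\<in>E. T a) / 2"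
  proof -
    have "complex_of_real (S x) * iexp (u * S x) =
        (\<Sum>a\<in>E. complex_of_real (noise a x * L a x) * iexp (u * S x)) / 2" for x
      by (simp add: S_def[of x] sum_distrib_right)
    hence "expect (\<lambda>x. complex_of_real (S x) * iexp (u * S x)) =
        expect (\<lambda>x. (\<Sum>a\<in>E. complex_of_real (noise a x * L a x) * iexp (u * S x)) / 2)"
      by presburger
    also have "\<dots> = (\<Sum>a\<in>E. T a) / 2"
      by (simp add: T_def)
    finally show ?thesis .
  qed
  have Q: "(\<Sum>a\<in>E. Q a) = z + card E * d * var * \<phi>"
  proof -
    have "(\<Sum>a\<in>E. complex_of_real ((L a x)\<^sup>2) * iexp (u * S x)) =
        complex_of_real (Z x) * iexp (u * S x) + card E * d * var * iexp (u * S x)" for x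
      by (simp add: Z_def sum_distrib_right[symmetric] algebra_simps)
    hence "expect (\<lambda>x. \<Sum>a\<in>E. complex_of_real ((L a x)\<^sup>2) * iexp (u * S x)) =
        expect (\<lambda>x. complex_of_real (Z x) * iexp (u * S x) + card E * d * var * iexp (u * S x))"
      by presburger
    thus ?thesis by (simp add: Q_def z_def \<phi>_def)
  qed
  have z: "norm z \<le> sqrt (6 * card E * real d ^ 3)"
  proof -
    have "norm z \<le> expect (\<lambda>x. norm (complex_of_real (Z x) * iexp (u * S x)))"
      unfolding z_def by (rule expect_norm_le)
    also have "\<dots> = expect (\<lambda>x. \<bar>Z x\<bar>)"
      by (simp add: norm_mult)
    also have "\<dots> \<le> sqrt (6 * card E * real d ^ 3)"
      by (rule expect_abs_le_sqrt[OF expect_Z_squared_le])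
    finally show ?thesis .
  qed
  have TQ: "norm (T a - \<i> * u * var * Q a) \<le> 12 * u\<^sup>2 * (d * sqrt d)" if a: "a \<in> E" for a
  proof -
    have "norm (T a - \<i> * u * var * Q a) \<le> 3 / 2 * u\<^sup>2 * expect (\<lambda>x. \<bar>L a x\<bar> ^ 3)"
      unfolding T_def Q_def by (rule edge_estimate[OF a])
    also have "\<dots> \<le> 3 / 2 * u\<^sup>2 * (7 * (d * sqrt d))"
      using expect_sum_noise_abs_cubed_le[OF nbrs_subset nbrs_nonempty[OF a]] card_nbrs[OF a]
      by (intro mult_left_mono) (auto simp: L_def)
    also have "\<dots> \<le> 12 * u\<^sup>2 * (d * sqrt d)"
      by (simp add: mult_right_mono)
    finally show ?thesis .
  qed
  have "(\<Sum>a\<in>E. T a) / 2 - \<i> * u * (var\<^sup>2 * card E * d / 2) * \<phi> =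
      (\<Sum>a\<in>E. T a - \<i> * u * var * Q a) / 2 + \<i> * u * var / 2 * z"
  proof -
    have eq: "(\<Sum>a\<in>E. T a - \<i> * u * var * Q a) = (\<Sum>a\<in>E. T a) - \<i> * u * var * (\<Sum>a\<in>E. Q a)"
      by (simp add: sum_subtractf sum_distrib_left)
    show ?thesis unfolding eq Q by (simp add: power2_eq_square field_simps)
  qed
  also have "norm \<dots> \<le> norm ((\<Sum>a\<in>E. T a - \<i> * u * var * Q a) / 2) + norm (\<i> * u * var / 2 * z)"
    by (rule norm_triangle_ineq)
  also have "norm ((\<Sum>a\<in>E. T a - \<i> * u * var * Q a) / 2) \<le> card E * (12 * u\<^sup>2 * (d * sqrt d)) / 2"
    using sum_norm_bound[of E "\<lambda>a. T a - \<i> * u * var * Q a", OF TQ] by (simp add: norm_divide mult_ac)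
  also have "norm (\<i> * u * var / 2 * z) = \<bar>u\<bar> / 2 * (var * norm z)"
    using var_pos by (simp add: norm_mult norm_divide)
  also have "\<bar>u\<bar> / 2 * (var * norm z) \<le> \<bar>u\<bar> / 2 * (1 * sqrt (6 * card E * real d ^ 3))"
    using var_pos by (intro mult_left_mono mult_mono var_le_1 z) auto
  finally show ?thesis unfolding T by (simp add: mult_ac add.commute)
qed

lemma char_derivative:
  "((\<lambda>u. expect (\<lambda>x. iexp (u * S x))) has_vector_derivative
     \<i> * expect (\<lambda>x. complex_of_real (S x) * iexp (u * S x))) (at u)"
proof -
  have sum: "expect f = (\<Sum>x\<in>set_pmf P. pmf P x *\<^sub>R f x)" for f :: "('e \<Rightarrow> bool) \<Rightarrow> complex"
    by (rule integral_measure_pmf[OF finite_set_P]) auto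
  have deriv: "((\<lambda>u. iexp (u * S x)) has_vector_derivative
      \<i> * (complex_of_real (S x) * iexp (u * S x))) (at u)" for x
  proof -
    have "((\<lambda>z. exp (\<i> * (z * complex_of_real (S x)))) has_field_derivative
        \<i> * (complex_of_real (S x) * iexp (u * S x))) (at (complex_of_real u))"
      by (auto intro!: derivative_eq_intros)
    from has_vector_derivative_real_field[OF this] show ?thesis by simp
  qed
  show ?thesis
    unfolding sum sum_distrib_left mult_scaleR_right
    by (intro has_vector_derivative_sum)
       (rule bounded_linear.has_vector_derivative[OF bounded_linear_scaleR_right deriv])
qed

text \<open>After division by \<open>s\<close>, the first error in \<open>stein_estimate\<close> has order
  \<open>sqrt (d / card E)\<close>, because \<open>Z\<close> is small, and the second has order \<open>1 / sqrt (card E)\<close>, which is no larger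
  as \<open>d\<close> is positive.\<close>

lemma char_quadratic_form:
  fixes t :: real
  defines "s \<equiv> var * sqrt (card E * d / 2)"
  shows "norm (expect (\<lambda>x. iexp (t * (S x / s))) - complex_of_real (exp (- t\<^sup>2 / 2)))
      \<le> 17 / var ^ 3 * sqrt (d / card E) * (t\<^sup>2 + \<bar>t\<bar> ^ 3)"
proof -
  \<comment> \<open>In these variables everything is a monomial: \<open>d = (q * r)\<^sup>2\<close> and \<open>s = var * q\<^sup>2 * r / sqrt 2\<close>.\<close>
  define q r where "q = sqrt (card E)" and "r = sqrt (d / card E)"
  define \<phi> \<phi>' where "\<phi> = (\<lambda>u. expect (\<lambda>x. iexp (u * S x)))"
    and "\<phi>' = (\<lambda>u. expect (\<lambda>x. complex_of_real (S x) * iexp (u * S x)))"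
  have card: "1 \<le> real (card E)"
    using E_nonempty finite_E by (simp add: Suc_le_eq card_gt_0_iff)
  have d: "1 \<le> real d" using d_pos by simp
  have pos: "0 < q" "0 < r" using card d by (simp_all add: q_def r_def)
  have N: "real (card E) = q\<^sup>2" by (simp add: q_def)
  have qr: "q * r = sqrt d" using card by (simp add: q_def r_def real_sqrt_divide)
  have d_eq: "real d = (q * r)\<^sup>2" unfolding qr by simp
  have qr1: "1 \<le> q * r" unfolding qr using d by simp
  have s: "s = var * (q\<^sup>2 * r) / sqrt 2"
    unfolding s_def
    by (simp add: real_sqrt_mult real_sqrt_divide qr[symmetric] q_def[symmetric] power2_eq_square)
  have s_pos: "0 < s" unfolding s using pos var_pos by simp
  have s2: "s\<^sup>2 = var\<^sup>2 * card E * d / 2"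
    unfolding s N d_eq by (simp add: power2_eq_square field_simps)
  have sqrt6: "sqrt (6 * card E * real d ^ 3) = sqrt 6 * (q ^ 4 * r ^ 3)"
  proof -
    have eq: "6 * card E * real d ^ 3 = 6 * (q ^ 4 * r ^ 3)\<^sup>2"
      by (simp add: N d_eq power_mult_distrib flip: power_mult power_add)
    show ?thesis unfolding eq using pos by (simp add: real_sqrt_mult)
  qed
  define \<delta> where "\<delta> = 17 / var ^ 3 * r"
  have "norm (\<phi> (t / s) - complex_of_real (exp (- t\<^sup>2 / 2))) \<le> \<delta> * (t\<^sup>2 + \<bar>t\<bar> ^ 3)"
  proof (rule norm_diff_gaussian_le[where \<psi> = "\<lambda>t. \<phi> (t / s)" and \<psi>' = "\<lambda>t. (1 / s) *\<^sub>R (\<i> * \<phi>' (t / s))"])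
    fix t
    have "((\<lambda>t. t / s) has_vector_derivative 1 / s) (at t)"
      using s_pos by (auto intro!: derivative_eq_intros simp: has_real_derivative_iff_has_vector_derivative[symmetric])
    moreover have "(\<phi> has_vector_derivative \<i> * \<phi>' (t / s)) (at (t / s))"
      unfolding \<phi>_def \<phi>'_def by (rule char_derivative)
    ultimately show "((\<lambda>t. \<phi> (t / s)) has_vector_derivative (1 / s) *\<^sub>R (\<i> * \<phi>' (t / s))) (at t)"
      using vector_diff_chain_at[of "\<lambda>t. t / s" "1 / s" t \<phi> "\<i> * \<phi>' (t / s)"] by (simp add: o_def)
  next
    show "\<phi> (0 / s) = 1" by (simp add: \<phi>_def)
  next
    fix t
    define u where "u = t / s"
    have t: "t = s * u" using s_pos by (simp add: u_def)
    have "(1 / s) *\<^sub>R (\<i> * \<phi>' u) + t *\<^sub>R \<phi> u = (1 / s) *\<^sub>R (\<i> * (\<phi>' u - \<i> * u * (s\<^sup>2) * \<phi> u))"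
      using s_pos by (simp add: t scaleR_conv_of_real field_simps power2_eq_square)
    also have "norm \<dots> = 1 / s * norm (\<phi>' u - \<i> * u * (s\<^sup>2) * \<phi> u)"
      using s_pos by (simp add: norm_mult)
    also have "\<dots> \<le> 1 / s *
        (\<bar>u\<bar> / 2 * sqrt (6 * card E * real d ^ 3) + 6 * u\<^sup>2 * card E * (d * sqrt d))"
      using stein_estimate[of u] s_pos unfolding s2 \<phi>_def \<phi>'_def
      by (intro mult_left_mono) simp_all
    also have "\<dots> = sqrt 6 * r / var\<^sup>2 * \<bar>t\<bar> + 12 * sqrt 2 / var ^ 3 * (1 / q) * t\<^sup>2"
    proof -
      have "1 / s * (\<bar>u\<bar> / 2 * (sqrt 6 * (q ^ 4 * r ^ 3))) = sqrt 6 * r / var\<^sup>2 * \<bar>t\<bar>"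
        using pos var_pos by (simp add: u_def s abs_divide abs_mult field_simps eval_nat_numeral)
      moreover have "1 / s * (6 * u\<^sup>2 * q\<^sup>2 * ((q * r)\<^sup>2 * (q * r))) = 12 * sqrt 2 / var ^ 3 * (1 / q) * t\<^sup>2"
        using pos var_pos by (simp add: u_def s abs_divide abs_mult field_simps eval_nat_numeral)
      ultimately show ?thesis
        unfolding sqrt6 unfolding N qr[symmetric] unfolding d_eq by (simp add: distrib_left)
    qed
    also have "\<dots> \<le> 17 * r / var ^ 3 * \<bar>t\<bar> + 17 / var ^ 3 * r * t\<^sup>2"
    proof (intro add_mono mult_right_mono)
      have "sqrt 6 \<le> 17" by (rule real_le_lsqrt) auto
      moreover have "var ^ 3 \<le> var ^ 2" using var_pos var_le_1 by (intro power_decreasing) auto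
      ultimately show "sqrt 6 * r / var\<^sup>2 \<le> 17 * r / var ^ 3"
        using pos var_pos by (intro frac_le mult_right_mono) auto
      \<comment> \<open>The constant 17 in the claim is chosen for this: its square is 289.\<close>
      have "12 * sqrt 2 = sqrt 288" 
        using real_sqrt_mult[of 144 2] by simp
      also have "\<dots> \<le> 17" by (rule real_le_lsqrt) auto
      finally have "12 * sqrt 2 / var ^ 3 \<le> 17 / var ^ 3"
        using var_pos by (intro divide_right_mono) auto
      moreover have "1 / q \<le> r" using qr1 pos by (simp add: field_simps)
      ultimately show "12 * sqrt 2 / var ^ 3 * (1 / q) \<le> 17 / var ^ 3 * r"
        using pos var_pos by (intro mult_mono) auto
    qed auto
    finally show "norm ((1 / s) *\<^sub>R (\<i> * \<phi>' (t / s)) + t *\<^sub>R \<phi> (t / s)) \<le> \<delta> * (\<bar>t\<bar> + t\<^sup>2)"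
      using s_pos by (simp add: \<delta>_def u_def distrib_left)
  qed
  thus ?thesis by (simp add: \<phi>_def \<delta>_def r_def)
qed

end

section \<open>Copies and embeddings\<close>

definition embeddings :: "'v graph \<Rightarrow> 'w graph \<Rightarrow> ('v \<Rightarrow> 'w) set" where
  "embeddings H G = {\<phi> \<in> verts H \<rightarrow>\<^sub>E verts G.
     inj_on \<phi> (verts H) \<and> (\<lambda>e. \<phi> ` e) ` edges H \<subseteq> edges G}"

text \<open>Fix an isomorphism from \<open>H\<close> onto each of its copies \<open>K\<close>. An embedding with image \<open>K\<close> is, in a unique
  way, an automorphism of \<open>H\<close> followed by the isomorphism onto \<open>K\<close>.\<close>

lemma card_embeddings:
  fixes H :: "'v graph" and G :: "'w graph"
  assumes H: "\<And>e. e \<in> edges H \<Longrightarrow> e \<subseteq> verts H"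
  shows "card (embeddings H G) = card (automorphisms H) * card (copies H G)"
proof -
  define iso where "iso = (\<lambda>K (\<psi> :: 'v \<Rightarrow> 'w).
    bij_betw \<psi> (verts H) (verts K) \<and> (\<lambda>e. \<psi> ` e) ` edges H = edges K)"
  define \<psi> where "\<psi> = (\<lambda>K. SOME \<psi>. iso K \<psi>)"
  have \<psi>: "iso K (\<psi> K)" if "K \<in> copies H G" for K
  proof -
    have "\<exists>\<psi>. iso K \<psi>"
      using that by (auto simp: copies_def isomorphic_def iso_def)
    thus ?thesis unfolding \<psi>_def by (rule someI_ex)
  qed
  define F where "F = (\<lambda>(\<alpha>, K). restrict (\<psi> K \<circ> \<alpha>) (verts H))"
  have F: "F (\<alpha>, K) ` verts H = verts K" "(\<lambda>e. F (\<alpha>, K) ` e) ` edges H = edges K"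
    "inj_on (F (\<alpha>, K)) (verts H)"
    if \<alpha>: "\<alpha> \<in> automorphisms H" and K: "K \<in> copies H G" for \<alpha> K
  proof -
    have perm: "\<alpha> permutes verts H" and \<alpha>E: "(\<lambda>e. \<alpha> ` e) ` edges H = edges H"
      using \<alpha> by (auto simp: automorphisms_def)
    have bij: "bij_betw (\<psi> K) (verts H) (verts K)" and \<psi>E: "(\<lambda>e. \<psi> K ` e) ` edges H = edges K"
      using \<psi>[OF K] by (auto simp: iso_def)
    have "bij_betw (\<psi> K \<circ> \<alpha>) (verts H) (verts K)"
      using bij_betw_trans[OF permutes_imp_bij[OF perm] bij] .
    thus "F (\<alpha>, K) ` verts H = verts K" "inj_on (F (\<alpha>, K)) (verts H)"
      by (auto simp: F_def bij_betw_def)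
    have "F (\<alpha>, K) ` e = \<psi> K ` (\<alpha> ` e)" if "e \<in> edges H" for e
      using H[OF that] by (auto simp: F_def)
    hence "(\<lambda>e. F (\<alpha>, K) ` e) ` edges H = (\<lambda>e. \<psi> K ` e) ` ((\<lambda>e. \<alpha> ` e) ` edges H)"
      by (auto simp: image_image)
    thus "(\<lambda>e. F (\<alpha>, K) ` e) ` edges H = edges K"
      unfolding \<alpha>E \<psi>E .
  qed
  have "bij_betw F (automorphisms H \<times> copies H G) (embeddings H G)"
    unfolding bij_betw_def
  proof (intro conjI equalityI subsetI)
    show "inj_on F (automorphisms H \<times> copies H G)"
    proof (rule inj_onI)
      fix a b assume ab: "a \<in> automorphisms H \<times> copies H G" "b \<in> automorphisms H \<times> copies H G"
        and "F a = F b"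
      then obtain \<alpha> K \<alpha>' K' where ab_eq: "a = (\<alpha>, K)" "b = (\<alpha>', K')"
        and eq: "F (\<alpha>, K) = F (\<alpha>', K')"
        by (cases a; cases b) blast
      have \<alpha>: "\<alpha> \<in> automorphisms H" "\<alpha>' \<in> automorphisms H" and K: "K \<in> copies H G" "K' \<in> copies H G"
        using ab by (simp_all add: ab_eq)
      have KK: "K = K'"
        using F(1,2)[OF \<alpha>(1) K(1)] F(1,2)[OF \<alpha>(2) K(2)] eq by (simp add: prod_eq_iff)
      have perm: "\<alpha> permutes verts H" "\<alpha>' permutes verts H"
        using \<alpha> by (auto simp: automorphisms_def)
      have inj: "inj_on (\<psi> K) (verts H)"
        using \<psi>[OF K(1)] by (auto simp: iso_def bij_betw_def)
      have "\<alpha> v = \<alpha>' v" for v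
      proof (cases "v \<in> verts H")
        case True
        hence "\<psi> K (\<alpha> v) = \<psi> K (\<alpha>' v)"
          using fun_cong[OF eq, of v] KK by (simp add: F_def)
        thus ?thesis
          using inj True perm by (auto simp: permutes_in_image inj_on_eq_iff)
      next
        case False
        thus ?thesis using perm by (simp add: permutes_not_in)
      qed
      thus "a = b" using KK by (auto simp: ab_eq)
    qed
  next
    fix \<phi> assume "\<phi> \<in> F ` (automorphisms H \<times> copies H G)"
    then obtain \<alpha> K where \<alpha>K: "\<alpha> \<in> automorphisms H" "K \<in> copies H G" and \<phi>: "\<phi> = F (\<alpha>, K)" by auto
    have "\<phi> \<in> extensional (verts H)" by (simp add: \<phi> F_def)
    moreover have "verts K \<subseteq> verts G" "edges K \<subseteq> edges G"
      using \<alpha>K(2) by (auto simp: copies_def)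
    ultimately show "\<phi> \<in> embeddings H G"
      using F[OF \<alpha>K] unfolding \<phi>[symmetric] by (auto simp: embeddings_def PiE_def)
  next
    fix \<phi> assume \<phi>: "\<phi> \<in> embeddings H G"
    define K where "K = (\<phi> ` verts H, (\<lambda>e. \<phi> ` e) ` edges H)"
    have inj\<phi>: "inj_on \<phi> (verts H)" using \<phi> by (simp add: embeddings_def)
    have K: "K \<in> copies H G"
      using \<phi> unfolding copies_def isomorphic_def
      by (auto simp: K_def embeddings_def inj_on_imp_bij_betw intro!: exI[of _ \<phi>])
    have bij: "bij_betw (\<psi> K) (verts H) (\<phi> ` verts H)"
      and \<psi>E: "(\<lambda>e. \<psi> K ` e) ` edges H = (\<lambda>e. \<phi> ` e) ` edges H"
      using \<psi>[OF K] by (auto simp: iso_def K_def)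
    define \<beta> where "\<beta> = inv_into (verts H) (\<psi> K)"
    have \<beta>: "bij_betw \<beta> (\<phi> ` verts H) (verts H)"
      unfolding \<beta>_def by (rule bij_betw_inv_into[OF bij])
    \<comment> \<open>An automorphism is a permutation of the whole type, so it has to be the identity off \<open>verts H\<close>.\<close>
    define \<alpha> where "\<alpha> = (\<lambda>v. if v \<in> verts H then \<beta> (\<phi> v) else v)"
    have "bij_betw (\<beta> \<circ> \<phi>) (verts H) (verts H)"
      using bij_betw_trans[OF inj_on_imp_bij_betw[OF inj\<phi>] \<beta>] .
    hence "bij_betw \<alpha> (verts H) (verts H)"
      by (rule bij_betw_cong[THEN iffD1, rotated]) (simp add: \<alpha>_def)
    hence perm: "\<alpha> permutes verts H"
      by (rule bij_imp_permutes) (simp add: \<alpha>_def)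
    have "(\<lambda>e. \<alpha> ` e) ` edges H = (\<lambda>e. \<beta> ` e) ` ((\<lambda>e. \<phi> ` e) ` edges H)"
      using H by (force simp: \<alpha>_def image_image intro!: image_cong)
    also have "\<dots> = (\<lambda>e. \<beta> ` (\<psi> K ` e)) ` edges H"
      unfolding \<psi>E[symmetric] by (simp add: image_image)
    also have "\<dots> = (\<lambda>e. e) ` edges H"
      by (intro image_cong refl) (simp add: \<beta>_def bij_betw_imp_inj_on[OF bij] H image_inv_into_cancel inv_into_image_cancel)
    finally have "\<alpha> \<in> automorphisms H" using perm by (simp add: automorphisms_def)
    moreover have "F (\<alpha>, K) = \<phi>"
    proof
      fix v
      show "F (\<alpha>, K) v = \<phi> v"
      proof (cases "v \<in> verts H")
        case True
        hence "\<psi> K (\<beta> (\<phi> v)) = \<phi> v"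
          unfolding \<beta>_def using bij by (intro bij_betw_inv_into_right) auto
        thus ?thesis using True by (simp add: F_def \<alpha>_def)
      next
        case False
        thus ?thesis using \<phi> by (auto simp: F_def embeddings_def PiE_def extensional_def)
      qed
    qed
    ultimately show "\<phi> \<in> F ` (automorphisms H \<times> copies H G)"
      using K by force
  qed
  from bij_betw_same_card[OF this] show ?thesis
    by (simp add: card_cartesian_product)
qed

text \<open>Tuples of distinct vertices, built up one entry at a time so that the last entry can be summed
  out.\<close>

definition tuples2 :: "'a set \<Rightarrow> ('a \<times> 'a) set" where
  "tuples2 V = {(a, b). a \<in> V \<and> b \<in> V \<and> a \<noteq> b}"

definition tuples3 :: "'a set \<Rightarrow> ('a \<times> 'a \<times> 'a) set" where
  "tuples3 V = {(a, b, c). (a, b) \<in> tuples2 V \<and> c \<in> V - {a, b}}"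

definition tuples4 :: "'a set \<Rightarrow> ('a \<times> 'a \<times> 'a \<times> 'a) set" where
  "tuples4 V = {(a, b, c, d). (a, b, c) \<in> tuples3 V \<and> d \<in> V - {a, b, c}}"

lemmas tuples_defs = tuples2_def tuples3_def tuples4_def

lemma finite_tuples [simp]:
  assumes "finite V"
  shows "finite (tuples2 V)" "finite (tuples3 V)" "finite (tuples4 V)"
proof -
  show "finite (tuples2 V)"
    by (rule finite_subset[of _ "V \<times> V"]) (use assms in \<open>auto simp: tuples_defs\<close>)
  show "finite (tuples3 V)"
    by (rule finite_subset[of _ "V \<times> V \<times> V"]) (use assms in \<open>auto simp: tuples_defs\<close>)
  show "finite (tuples4 V)"
    by (rule finite_subset[of _ "V \<times> V \<times> V \<times> V"]) (use assms in \<open>auto simp: tuples_defs\<close>)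
qed

lemma sum_tuples3:
  fixes g :: "'a \<Rightarrow> 'a \<Rightarrow> real"
  assumes "finite V"
  shows "(\<Sum>(a, b, c)\<in>tuples3 V. g a b) = (real (card V) - 2) * (\<Sum>(a, b)\<in>tuples2 V. g a b)"
proof -
  have "(\<Sum>(a, b, c)\<in>tuples3 V. g a b) =
      (\<Sum>(t, c)\<in>(SIGMA t:tuples2 V. V - {fst t, snd t}). g (fst t) (snd t))"
    by (rule sum.reindex_bij_witness[of _ "\<lambda>((a, b), c). (a, b, c)" "\<lambda>(a, b, c). ((a, b), c)"])
       (auto simp: tuples3_def)
  also have "\<dots> = (\<Sum>t\<in>tuples2 V. \<Sum>c\<in>V - {fst t, snd t}. g (fst t) (snd t))"
    using assms by (subst sum.Sigma) auto
  also have "\<dots> = (\<Sum>t\<in>tuples2 V. (real (card V) - 2) * g (fst t) (snd t))"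
  proof (intro sum.cong refl)
    fix t assume t: "t \<in> tuples2 V"
    have "card {fst t, snd t} = 2" using t by (auto simp: tuples2_def)
    hence "real (card (V - {fst t, snd t})) = real (card V) - 2"
      using t assms card_mono[of V "{fst t, snd t}"]
      by (subst card_Diff_subset) (auto simp: tuples2_def of_nat_diff)
    thus "(\<Sum>c\<in>V - {fst t, snd t}. g (fst t) (snd t)) = (real (card V) - 2) * g (fst t) (snd t)"
      by simp
  qed
  finally show ?thesis by (simp add: sum_distrib_left case_prod_beta)
qed

lemma sum_tuples4:
  fixes g :: "'a \<Rightarrow> 'a \<Rightarrow> 'a \<Rightarrow> real"
  assumes "finite V"
  shows "(\<Sum>(a, b, c, d)\<in>tuples4 V. g a b c) = (real (card V) - 3) * (\<Sum>(a, b, c)\<in>tuples3 V. g a b c)"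
proof -
  have "(\<Sum>(a, b, c, d)\<in>tuples4 V. g a b c) =
      (\<Sum>((a, b, c), d)\<in>(SIGMA t:tuples3 V. V - {fst t, fst (snd t), snd (snd t)}). g a b c)"
    by (rule sum.reindex_bij_witness[of _ "\<lambda>((a, b, c), d). (a, b, c, d)" "\<lambda>(a, b, c, d). ((a, b, c), d)"])
       (auto simp: tuples4_def)
  also have "\<dots> = (\<Sum>t\<in>tuples3 V. \<Sum>d\<in>V - {fst t, fst (snd t), snd (snd t)}. g (fst t) (fst (snd t)) (snd (snd t)))"
    using assms by (subst sum.Sigma) (auto simp: case_prod_unfold)
  also have "\<dots> = (\<Sum>t\<in>tuples3 V. (real (card V) - 3) * g (fst t) (fst (snd t)) (snd (snd t)))"
  proof (intro sum.cong refl)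
    fix t assume t: "t \<in> tuples3 V"
    have "card {fst t, fst (snd t), snd (snd t)} = 3" using t by (auto simp: tuples_defs)
    hence "real (card (V - {fst t, fst (snd t), snd (snd t)})) = real (card V) - 3"
      using t assms card_mono[of V "{fst t, fst (snd t), snd (snd t)}"]
      by (subst card_Diff_subset) (auto simp: tuples_defs of_nat_diff)
    thus "(\<Sum>c\<in>V - {fst t, fst (snd t), snd (snd t)}. g (fst t) (fst (snd t)) (snd (snd t))) =
        (real (card V) - 3) * g (fst t) (fst (snd t)) (snd (snd t))"
      by simp
  qed
  finally show ?thesis by (simp add: sum_distrib_left case_prod_beta)
qed

text \<open>The rotational symmetry of the cycle, which will identify the terms of the expansion that
  differ by a shift of the vertices.\<close>

lemma sum_tuples4_rotate:
  "(\<Sum>(a, b, c, d)\<in>tuples4 V. g b c d a) = (\<Sum>(a, b, c, d)\<in>tuples4 V. g a b c d)"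
  by (rule sum.reindex_bij_witness[of _ "\<lambda>(a, b, c, d). (d, a, b, c)" "\<lambda>(a, b, c, d). (b, c, d, a)"])
     (auto simp: tuples_defs)

lemma card_tuples2: "finite V \<Longrightarrow> real (card (tuples2 V)) = real (card V) * (real (card V) - 1)"
proof -
  assume fin: "finite V"
  have "tuples2 V = (SIGMA a:V. V - {a})" by (auto simp: tuples2_def)
  hence "card (tuples2 V) = card V * (card V - 1)"
    using fin by (simp add: card_SigmaI card_Diff_singleton)
  thus ?thesis by (cases "card V") (auto simp: algebra_simps)
qed

lemma card_tuples4:
  assumes "finite V"
  shows "real (card (tuples4 V)) =
    real (card V) * (real (card V) - 1) * (real (card V) - 2) * (real (card V) - 3)"
  using sum_tuples4[OF assms, of "\<lambda>_ _ _. 1"] sum_tuples3[OF assms, of "\<lambda>_ _. 1"] card_tuples2[OF assms]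
  by (simp add: case_prod_unfold)

lemma card_embeddings_K2:
  "card (embeddings K2 G) = card {(a, b) \<in> tuples2 (verts G). {a, b} \<in> edges G}"
proof (rule bij_betw_same_card)
  show "bij_betw (\<lambda>\<phi>. (\<phi> 1, \<phi> 2)) (embeddings K2 G) {(a, b) \<in> tuples2 (verts G). {a, b} \<in> edges G}"
    by (rule bij_betw_byWitness[where f' = "\<lambda>(a, b). \<lambda>i\<in>{1, 2}. if i = 1 then a else b"])
       (auto simp: embeddings_def K2_def tuples_defs PiE_iff extensional_def restrict_def)
qed

lemma card_embeddings_C4:
  "card (embeddings C4 G) = card {(a, b, c, d) \<in> tuples4 (verts G).
     {a, b} \<in> edges G \<and> {b, c} \<in> edges G \<and> {c, d} \<in> edges G \<and> {d, a} \<in> edges G}"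
proof (rule bij_betw_same_card)
  show "bij_betw (\<lambda>\<phi>. (\<phi> 1, \<phi> 2, \<phi> 3, \<phi> 4)) (embeddings C4 G) {(a, b, c, d) \<in> tuples4 (verts G).
     {a, b} \<in> edges G \<and> {b, c} \<in> edges G \<and> {c, d} \<in> edges G \<and> {d, a} \<in> edges G}"
    by (rule bij_betw_byWitness[where f' = "\<lambda>(a, b, c, d). \<lambda>i\<in>{1, 2, 3, 4}.
          if i = 1 then a else if i = 2 then b else if i = 3 then c else d"])
       (auto simp: embeddings_def C4_def tuples_defs PiE_iff extensional_def restrict_def)
qed

lemma t_hat_eq_embeddings:
  assumes "\<And>e. e \<in> edges H \<Longrightarrow> e \<subseteq> verts H"
  shows "t_hat H G = card (embeddings H G) / falling_factorial (card (verts G)) (card (verts H))"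
  using card_embeddings[of H G] assms by (simp add: t_hat_def)

lemma t_hat_K2:
  assumes "finite (verts G)"
  shows "t_hat K2 G = (\<Sum>(a, b)\<in>tuples2 (verts G). of_bool ({a, b} \<in> edges G)) /
    (real (card (verts G)) * (real (card (verts G)) - 1))"
proof -
  have "real (card (embeddings K2 G)) = (\<Sum>(a, b)\<in>tuples2 (verts G). of_bool ({a, b} \<in> edges G))"
    using assms by (simp add: card_embeddings_K2 case_prod_unfold Int_def)
  moreover have "falling_factorial m (card (verts K2)) = real m * (real m - 1)" for m
    by (simp add: K2_def falling_factorial_def numeral_2_eq_2)
  ultimately show ?thesis
    by (subst t_hat_eq_embeddings) (auto simp: K2_def)
qed

lemma t_hat_C4:
  assumes "finite (verts G)"
  shows "t_hat C4 G = (\<Sum>(a, b, c, d)\<in>tuples4 (verts G).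
      of_bool ({a, b} \<in> edges G) * of_bool ({b, c} \<in> edges G) *
      of_bool ({c, d} \<in> edges G) * of_bool ({d, a} \<in> edges G)) /
    (real (card (verts G)) * (real (card (verts G)) - 1) * (real (card (verts G)) - 2) *
     (real (card (verts G)) - 3))"
proof -
  have "real (card (embeddings C4 G)) = (\<Sum>(a, b, c, d)\<in>tuples4 (verts G).
      of_bool ({a, b} \<in> edges G) * of_bool ({b, c} \<in> edges G) *
      of_bool ({c, d} \<in> edges G) * of_bool ({d, a} \<in> edges G))"
    using assms by (simp add: card_embeddings_C4 case_prod_unfold Int_def flip: of_bool_conj)
  moreover have "falling_factorial m (card (verts C4)) = real m * (real m - 1) * (real m - 2) * (real m - 3)" for m
    by (simp add: C4_def falling_factorial_def eval_nat_numeral)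
  ultimately show ?thesis
    by (subst t_hat_eq_embeddings) (auto simp: C4_def)
qed

section \<open>Expansion of the estimator in edge noise\<close>

definition slots :: "nat \<Rightarrow> nat set set" where
  "slots n = {e. e \<subseteq> {1..n} \<and> card e = 2}"

definition incident :: "'a set \<Rightarrow> 'a set \<Rightarrow> bool" where
  "incident e f \<longleftrightarrow> e \<noteq> f \<and> e \<inter> f \<noteq> {}"

lemma finite_slots: "finite (slots n)"
  by (rule finite_subset[of _ "Pow {1..n}"]) (auto simp: slots_def)

lemma card_slots: "card (slots n) = n choose 2"
  using n_subsets[of "{1..n}" 2] by (simp add: slots_def)

lemma doubleton_in_slots_iff: "{a, b} \<in> slots n \<longleftrightarrow> a \<in> {1..n} \<and> b \<in> {1..n} \<and> a \<noteq> b"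
  by (auto simp: slots_def card_2_iff doubleton_eq_iff)

lemma slotsE:
  assumes "e \<in> slots n"
  obtains a b where "e = {a, b}" "a \<noteq> b" "a \<in> {1..n}" "b \<in> {1..n}"
  using assms by (auto simp: slots_def card_2_iff)

lemma card_incident_slots:
  assumes "e \<in> slots n"
  shows "card {f \<in> slots n. incident e f} = 2 * (n - 2)"
proof -
  obtain a b where e: "e = {a, b}" "a \<noteq> b" "a \<in> {1..n}" "b \<in> {1..n}"
    using assms by (rule slotsE)
  have "{f \<in> slots n. incident e f} =
      (\<lambda>c. {a, c}) ` ({1..n} - {a, b}) \<union> (\<lambda>c. {b, c}) ` ({1..n} - {a, b})"
  proof (intro equalityI subsetI)
    fix f assume "f \<in> {f \<in> slots n. incident e f}"
    hence f: "f \<in> slots n" "incident e f" by auto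
    obtain c d where "f = {c, d}" "c \<noteq> d" "c \<in> {1..n}" "d \<in> {1..n}"
      using f(1) by (rule slotsE)
    thus "f \<in> (\<lambda>c. {a, c}) ` ({1..n} - {a, b}) \<union> (\<lambda>c. {b, c}) ` ({1..n} - {a, b})"
      using f(2) e by (auto simp: incident_def doubleton_eq_iff image_iff)
  qed (use e in \<open>auto simp: incident_def doubleton_eq_iff doubleton_in_slots_iff\<close>)
  moreover have "card ((\<lambda>c. {a, c}) ` ({1..n} - {a, b})) = n - 2"
    using e by (subst card_image) (auto simp: inj_on_def doubleton_eq_iff card_Diff_subset)
  moreover have "card ((\<lambda>c. {b, c}) ` ({1..n} - {a, b})) = n - 2"
    using e by (subst card_image) (auto simp: inj_on_def doubleton_eq_iff card_Diff_subset)
  moreover have "(\<lambda>c. {a, c}) ` ({1..n} - {a, b}) \<inter> (\<lambda>c. {b, c}) ` ({1..n} - {a, b}) = {}"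
    using e by (auto simp: doubleton_eq_iff)
  ultimately show ?thesis by (simp add: card_Un_disjoint)
qed

text \<open>Two different edges with a common vertex determine that vertex, hence the path formed by
  them and its direction.\<close>

lemma bij_betw_cherries:
  "bij_betw (\<lambda>(a, b, c). ({a, b}, {b, c})) (tuples3 {1..n})
     {(e, f) \<in> slots n \<times> slots n. incident e f}"
  unfolding bij_betw_def
proof (intro conjI equalityI subsetI)
  show "inj_on (\<lambda>(a, b, c). ({a, b}, {b, c})) (tuples3 {1..n})"
  proof (rule inj_onI)
    fix s t assume st: "s \<in> tuples3 {1..n}" "t \<in> tuples3 {1..n}"
      "(\<lambda>(a, b, c). ({a, b}, {b, c})) s = (\<lambda>(a, b, c). ({a, b}, {b, c})) t"
    obtain a b c a' b' c' where "s = (a, b, c)" "t = (a', b', c')" by (cases s; cases t)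
    thus "s = t" using st by (auto simp: tuples_defs doubleton_eq_iff)
  qed
next
  fix z assume "z \<in> (\<lambda>(a, b, c). ({a, b}, {b, c})) ` tuples3 {1..n}"
  then obtain a b c where "z = ({a, b}, {b, c})" "(a, b, c) \<in> tuples3 {1..n}" by (elim imageE) auto
  thus "z \<in> {(e, f) \<in> slots n \<times> slots n. incident e f}"
    by (simp add: tuples_defs doubleton_in_slots_iff incident_def doubleton_eq_iff)
next
  fix z assume "z \<in> {(e, f) \<in> slots n \<times> slots n. incident e f}"
  then obtain e f where z: "z = (e, f)" "e \<in> slots n" "f \<in> slots n" "incident e f" by auto
  have "e \<noteq> f" using z(4) by (simp add: incident_def)
  obtain a b where e: "e = {a, b}" "a \<noteq> b" "a \<in> {1..n}" "b \<in> {1..n}"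
    using z(2) by (rule slotsE)
  obtain c d where f: "f = {c, d}" "c \<noteq> d" "c \<in> {1..n}" "d \<in> {1..n}"
    using z(3) by (rule slotsE)
  have "\<exists>u v w. e = {u, v} \<and> f = {v, w} \<and> (u, v, w) \<in> tuples3 {1..n}"
  proof -
    consider "b = c" | "b = d" | "a = c" | "a = d"
      using z(4) unfolding e(1) f(1) incident_def by blast
    thus ?thesis
    proof cases
      case 1
      hence "e = {a, b}" "f = {b, d}" using e(1) f(1) by auto
      moreover from this have "(a, b, d) \<in> tuples3 {1..n}"
        using e(2-4) f(2-4) \<open>e \<noteq> f\<close> 1 by (auto simp: tuples_defs)
      ultimately show ?thesis by blast
    next
      case 2
      hence "e = {a, b}" "f = {b, c}" using e(1) f(1) by auto
      moreover from this have "(a, b, c) \<in> tuples3 {1..n}"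
        using e(2-4) f(2-4) \<open>e \<noteq> f\<close> 2 by (auto simp: tuples_defs)
      ultimately show ?thesis by blast
    next
      case 3
      hence "e = {b, a}" "f = {a, d}" using e(1) f(1) by auto
      moreover from this have "(b, a, d) \<in> tuples3 {1..n}"
        using e(2-4) f(2-4) \<open>e \<noteq> f\<close> 3 by (auto simp: tuples_defs)
      ultimately show ?thesis by blast
    next
      case 4
      hence "e = {b, a}" "f = {a, c}" using e(1) f(1) by auto
      moreover from this have "(b, a, c) \<in> tuples3 {1..n}"
        using e(2-4) f(2-4) \<open>e \<noteq> f\<close> 4 by (auto simp: tuples_defs)
      ultimately show ?thesis by blast
    qed
  qed
  then obtain u v w where "e = {u, v}" "f = {v, w}" "(u, v, w) \<in> tuples3 {1..n}" by blast
  thus "z \<in> (\<lambda>(a, b, c). ({a, b}, {b, c})) ` tuples3 {1..n}"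
    unfolding z(1) by (intro image_eqI[of _ _ "(u, v, w)"]) simp_all
qed

text \<open>Four vertices make all falling factorials in the two densities positive.\<close>

locale random_edges =
  fixes n :: nat and p :: real
  assumes n_ge_4: "4 \<le> n" and p_pos': "0 < p" and p_less_1': "p < 1"

sublocale random_edges \<subseteq> regular_quadratic_form "slots n" p incident "2 * (n - 2)"
proof
  have "{1, 2} \<in> slots n" using n_ge_4 by (simp add: doubleton_in_slots_iff)
  thus "slots n \<noteq> {}" by blast
qed (use n_ge_4 p_pos' p_less_1' card_incident_slots[of _ n] in
  \<open>auto simp: finite_slots incident_def Int_commute\<close>)

definition bit_graph :: "nat \<Rightarrow> (nat set \<Rightarrow> bool) \<Rightarrow> nat graph" where
  "bit_graph n x = ({1..n}, {e \<in> slots n. x e})"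

lemma measurable_bit_graph:
  "bit_graph n \<in> measurable (measure_pmf Q) (count_space (simple_graphs_on {1..n}))"
  unfolding measurable_pmf_measure1
  by (intro funcsetI) (simp add: bit_graph_def simple_graphs_on_def slots_def, blast)

context random_edges
begin

abbreviation "V \<equiv> {1..n}"

text \<open>A path can be read from either end, hence the factor 2.\<close>

lemma sum_cherries: "(\<Sum>(a, b, c)\<in>tuples3 V. noise {a, b} x * noise {b, c} x) = 2 * S x"
proof -
  have "(\<Sum>(a, b, c)\<in>tuples3 V. noise {a, b} x * noise {b, c} x) =
      (\<Sum>(e, f)\<in>{(e, f) \<in> slots n \<times> slots n. incident e f}. noise e x * noise f x)"
    by (subst sum.reindex_bij_betw[OF bij_betw_cherries, symmetric]) (simp add: case_prod_unfold)
  also have "{(e, f) \<in> slots n \<times> slots n. incident e f} = (SIGMA e:slots n. nbrs e)"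
    by (auto simp: nbrs_def)
  also have "(\<Sum>(e, f)\<in>\<dots>. noise e x * noise f x) = (\<Sum>e\<in>slots n. \<Sum>f\<in>nbrs e. noise e x * noise f x)"
    by (subst sum.Sigma) (auto simp: finite_slots)
  also have "\<dots> = (\<Sum>e\<in>slots n. noise e x * L e x)" by (simp add: L_def sum_distrib_left)
  also have "\<dots> = 2 * S x" by (simp add: S_def)
  finally show ?thesis .
qed

text \<open>The edges in \<open>A t\<close> cover the four entries of \<open>t\<close>, so any \<open>u\<close> with \<open>A u = A t\<close> is one of the
  \<open>4 ^ 4\<close> tuples with entries among those of \<open>t\<close>. With this multiplicity, \<open>second_moment_le\<close> says that
  the sum is as small as a sum of uncorrelated terms, up to a constant.\<close>

lemma expect_tuples4_le:
  fixes A :: "nat \<times> nat \<times> nat \<times> nat \<Rightarrow> nat set set"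
  assumes "\<And>a b c d. (a, b, c, d) \<in> tuples4 V \<Longrightarrow> A (a, b, c, d) \<subseteq> slots n"
    and cover: "\<And>a b c d. \<Union> (A (a, b, c, d)) = {a, b, c, d}"
  shows "expect (\<lambda>x. \<bar>\<Sum>t\<in>tuples4 V. chi (A t) x\<bar>) \<le> 16 * sqrt (card (tuples4 V))"
proof -
  have "expect (\<lambda>x. (\<Sum>t\<in>tuples4 V. 1 * chi (A t) x)\<^sup>2) \<le> real 256 * (\<Sum>t\<in>tuples4 V. 1\<^sup>2)"
  proof (rule second_moment_le)
    fix t assume t: "t \<in> tuples4 V"
    obtain a b c d where abcd: "t = (a, b, c, d)" by (cases t)
    let ?T = "{a, b, c, d}"
    have sub: "{u \<in> tuples4 V. A u = A t} \<subseteq> ?T \<times> ?T \<times> ?T \<times> ?T"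
    proof
      fix u assume "u \<in> {u \<in> tuples4 V. A u = A t}"
      moreover obtain a' b' c' d' where u: "u = (a', b', c', d')" by (cases u)
      ultimately have "{a', b', c', d'} = ?T"
        using cover[of a' b' c' d'] cover[of a b c d] abcd by simp
      thus "u \<in> ?T \<times> ?T \<times> ?T \<times> ?T" unfolding u by blast
    qed
    have T: "card ?T = 4" using t abcd by (auto simp: tuples_defs)
    have "card {u \<in> tuples4 V. A u = A t} \<le> card (?T \<times> ?T \<times> ?T \<times> ?T)"
      by (rule card_mono[OF _ sub]) simp
    also have "\<dots> = 256" by (simp add: card_cartesian_product T del: card_insert_disjoint insert_Times_insert)
    finally show "card {u \<in> tuples4 V. A u = A t} \<le> 256" .
    show "A t \<subseteq> slots n" using assms(1) t abcd by simp
  qed simp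
  hence "expect (\<lambda>x. (\<Sum>t\<in>tuples4 V. chi (A t) x)\<^sup>2) \<le> 256 * card (tuples4 V)"
    by simp
  from expect_abs_le_sqrt[OF this] show ?thesis
    by (simp add: real_sqrt_mult)
qed

text \<open>The terms of the product of four edge indicators in which noise touches all four vertices:
  two opposite edges, paths with three edges, and the full cycle.\<close>

definition rem4 :: "(nat set \<Rightarrow> bool) \<Rightarrow> real" where
  "rem4 x = (\<Sum>(a, b, c, d)\<in>tuples4 V.
     p\<^sup>2 * (chi {{a, b}, {c, d}} x + chi {{b, c}, {d, a}} x) +
     p * (chi {{a, b}, {b, c}, {c, d}} x + chi {{b, c}, {c, d}, {d, a}} x +
          chi {{c, d}, {d, a}, {a, b}} x + chi {{d, a}, {a, b}, {b, c}} x) +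
     chi {{a, b}, {b, c}, {c, d}, {d, a}} x)"

lemma expect_rem4_le: "expect (\<lambda>x. \<bar>rem4 x\<bar>) \<le> 112 * sqrt (card (tuples4 V))"
proof -
  define X where "X = (\<lambda>A x. \<Sum>t\<in>tuples4 V. chi (A t) x)"
  define A :: "nat \<Rightarrow> nat \<times> nat \<times> nat \<times> nat \<Rightarrow> nat set set" where
    "A = (\<lambda>k (a, b, c, d). [{{a, b}, {c, d}}, {{b, c}, {d, a}}, {{a, b}, {b, c}, {c, d}},
      {{b, c}, {c, d}, {d, a}}, {{c, d}, {d, a}, {a, b}}, {{d, a}, {a, b}, {b, c}},
      {{a, b}, {b, c}, {c, d}, {d, a}}] ! k)"
  have X: "expect (\<lambda>x. \<bar>X (A k) x\<bar>) \<le> 16 * sqrt (card (tuples4 V))" if "k < 7" for k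
    unfolding X_def
  proof (rule expect_tuples4_le)
    from that have k: "k \<in> {0, 1, 2, 3, 4, 5, 6}" by auto
    show "A k (a, b, c, d) \<subseteq> slots n" if "(a, b, c, d) \<in> tuples4 V" for a b c d
      using that(1) k by (auto simp: A_def tuples_defs doubleton_in_slots_iff)
    show "\<Union> (A k (a, b, c, d)) = {a, b, c, d}" for a b c d
      using k by (auto simp: A_def)
  qed
  have "\<bar>rem4 x\<bar> \<le> (\<Sum>k<7. \<bar>X (A k) x\<bar>)" for x
  proof -
    have eq: "rem4 x = p\<^sup>2 * X (A 0) x + p\<^sup>2 * X (A 1) x + p * X (A 2) x + p * X (A 3) x +
        p * X (A 4) x + p * X (A 5) x + X (A 6) x"
      by (simp add: rem4_def X_def A_def case_prod_unfold sum.distrib sum_distrib_left algebra_simps)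
    have p: "\<bar>p * y\<bar> \<le> \<bar>y\<bar>" "\<bar>p\<^sup>2 * y\<bar> \<le> \<bar>y\<bar>" for y
      using p_pos p_less_1 by (auto simp: abs_mult power_le_one intro: mult_left_le_one_le)
    have "(\<Sum>k<7. \<bar>X (A k) x\<bar>) = \<bar>X (A 0) x\<bar> + \<bar>X (A 1) x\<bar> + \<bar>X (A 2) x\<bar> + \<bar>X (A 3) x\<bar> +
        \<bar>X (A 4) x\<bar> + \<bar>X (A 5) x\<bar> + \<bar>X (A 6) x\<bar>"
      by (simp add: eval_nat_numeral)
    thus ?thesis
      unfolding eq by (simp only:) (intro order_trans[OF abs_triangle_ineq] add_mono p order_refl)
  qed
  hence "expect (\<lambda>x. \<bar>rem4 x\<bar>) \<le> expect (\<lambda>x. \<Sum>k<7. \<bar>X (A k) x\<bar>)"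
    by (rule expect_mono)
  also have "\<dots> = (\<Sum>k<7. expect (\<lambda>x. \<bar>X (A k) x\<bar>))" by simp
  also have "\<dots> \<le> (\<Sum>k<(7::nat). 16 * sqrt (card (tuples4 V)))"
    by (intro sum_mono X) auto
  finally show ?thesis by simp
qed

definition mean_noise :: "(nat set \<Rightarrow> bool) \<Rightarrow> real" where
  "mean_noise x = (\<Sum>(a, b)\<in>tuples2 V. noise {a, b} x) / card (tuples2 V)"

lemma card_tuples_V:
  "real (card (tuples2 V)) = real n * (real n - 1)"
  "real (card (tuples4 V)) = real n * (real n - 1) * (real n - 2) * (real n - 3)"
  by (simp_all add: card_tuples2 card_tuples4)

lemma card_tuples_V_pos: "0 < real (card (tuples2 V))" "0 < real (card (tuples4 V))"
  using n_ge_4 unfolding card_tuples_V by auto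

lemma tuples_V_nonempty: "tuples2 V \<noteq> {}" "tuples4 V \<noteq> {}"
  using card_tuples_V_pos by (metis card.empty less_irrefl of_nat_0)+

lemma of_bool_edge:
  assumes "a \<in> V" "b \<in> V" "a \<noteq> b"
  shows "of_bool ({a, b} \<in> edges (bit_graph n x)) = p + noise {a, b} x"
  using assms by (simp add: bit_graph_def noise_def doubleton_in_slots_iff)

lemma t_hat_K2_bit_graph: "t_hat K2 (bit_graph n x) = p + mean_noise x"
proof -
  have "(\<Sum>(a, b)\<in>tuples2 V. of_bool ({a, b} \<in> edges (bit_graph n x))) =
      (\<Sum>(a, b)\<in>tuples2 V. p + noise {a, b} x)"
    by (rule sum.cong) (auto simp: tuples2_def of_bool_edge simp del: of_bool_eq_iff)
  also have "\<dots> = p * card (tuples2 V) + (\<Sum>(a, b)\<in>tuples2 V. noise {a, b} x)"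
    by (simp add: case_prod_unfold sum.distrib)
  finally have "(\<Sum>(a, b)\<in>tuples2 V. of_bool ({a, b} \<in> edges (bit_graph n x))) =
      p * card (tuples2 V) + (\<Sum>(a, b)\<in>tuples2 V. noise {a, b} x)" .
  moreover have "t_hat K2 (bit_graph n x) =
      (\<Sum>(a, b)\<in>tuples2 V. of_bool ({a, b} \<in> edges (bit_graph n x))) / card (tuples2 V)"
    unfolding card_tuples_V using t_hat_K2[of "bit_graph n x"] by (simp add: bit_graph_def)
  ultimately show ?thesis
    using tuples_V_nonempty(1) by (simp only: mean_noise_def add_divide_distrib) simp
qed

text \<open>Rotation identifies the four linear terms with each other, and likewise the four pairs of
  adjacent edges. The vertices that these do not touch are then summed out.\<close>

lemma sum_tuples4_edges:
  "(\<Sum>(a, b, c, d)\<in>tuples4 V. (p + noise {a, b} x) * (p + noise {b, c} x) *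
       (p + noise {c, d} x) * (p + noise {d, a} x)) =
   card (tuples4 V) * (p ^ 4 + 4 * p ^ 3 * mean_noise x) + 8 * p\<^sup>2 * (real n - 3) * S x + rem4 x"
proof -
  define \<Sigma> where "\<Sigma> = (\<lambda>g :: nat \<Rightarrow> nat \<Rightarrow> nat \<Rightarrow> nat \<Rightarrow> real. \<Sum>(a, b, c, d)\<in>tuples4 V. g a b c d)"
  have rot: "\<Sigma> (\<lambda>a b c d. g b c d a) = \<Sigma> g" for g
    unfolding \<Sigma>_def by (rule sum_tuples4_rotate)
  have distrib: "\<Sigma> (\<lambda>a b c d. f a b c d + g a b c d) = \<Sigma> f + \<Sigma> g" for f g
    by (simp add: \<Sigma>_def case_prod_unfold sum.distrib)
  have scale: "\<Sigma> (\<lambda>a b c d. k * f a b c d) = k * \<Sigma> f" for k f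
    by (simp add: \<Sigma>_def case_prod_unfold sum_distrib_left)
  let ?e = "\<lambda>a b. noise {a, b} x"
  have "(\<Sum>(a, b, c, d)\<in>tuples4 V. (p + ?e a b) * (p + ?e b c) * (p + ?e c d) * (p + ?e d a)) =
    \<Sigma> (\<lambda>a b c d. p ^ 4 + p ^ 3 * (?e a b + ?e b c + ?e c d + ?e d a) +
      p\<^sup>2 * (?e a b * ?e b c + ?e b c * ?e c d + ?e c d * ?e d a + ?e d a * ?e a b) +
     (p\<^sup>2 * (chi {{a, b}, {c, d}} x + chi {{b, c}, {d, a}} x) +
     p * (chi {{a, b}, {b, c}, {c, d}} x + chi {{b, c}, {c, d}, {d, a}} x +
          chi {{c, d}, {d, a}, {a, b}} x + chi {{d, a}, {a, b}, {b, c}} x) +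
     chi {{a, b}, {b, c}, {c, d}, {d, a}} x))"
    unfolding \<Sigma>_def
  proof (intro sum.cong refl)
    fix t assume t: "t \<in> tuples4 V"
    obtain a b c d where abcd: "t = (a, b, c, d)" by (cases t)
    define e1 e2 e3 e4 where e: "e1 = {a, b}" "e2 = {b, c}" "e3 = {c, d}" "e4 = {d, a}"
    \<comment> \<open>Only for distinct edges is a product of noise variables one of the functions chi.\<close>
    have ne: "e1 \<noteq> e2" "e1 \<noteq> e3" "e1 \<noteq> e4" "e2 \<noteq> e3" "e2 \<noteq> e4" "e3 \<noteq> e4"
      using t unfolding abcd e by (auto simp: tuples_defs doubleton_eq_iff)
    show "(case t of (a, b, c, d) \<Rightarrow> (p + ?e a b) * (p + ?e b c) * (p + ?e c d) * (p + ?e d a)) =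
      (case t of (a, b, c, d) \<Rightarrow> p ^ 4 + p ^ 3 * (?e a b + ?e b c + ?e c d + ?e d a) +
      p\<^sup>2 * (?e a b * ?e b c + ?e b c * ?e c d + ?e c d * ?e d a + ?e d a * ?e a b) +
     (p\<^sup>2 * (chi {{a, b}, {c, d}} x + chi {{b, c}, {d, a}} x) +
     p * (chi {{a, b}, {b, c}, {c, d}} x + chi {{b, c}, {c, d}, {d, a}} x +
          chi {{c, d}, {d, a}, {a, b}} x + chi {{d, a}, {a, b}, {b, c}} x) +
     chi {{a, b}, {b, c}, {c, d}, {d, a}} x))"
      unfolding abcd prod.case e[symmetric] using ne ne[symmetric]
      by (simp add: chi_def eval_nat_numeral algebra_simps)
  qed
  also have "\<dots> = \<Sigma> (\<lambda>a b c d. p ^ 4) +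
      p ^ 3 * (\<Sigma> (\<lambda>a b c d. ?e a b) + \<Sigma> (\<lambda>a b c d. ?e b c) + \<Sigma> (\<lambda>a b c d. ?e c d) + \<Sigma> (\<lambda>a b c d. ?e d a)) +
      p\<^sup>2 * (\<Sigma> (\<lambda>a b c d. ?e a b * ?e b c) + \<Sigma> (\<lambda>a b c d. ?e b c * ?e c d) +
        \<Sigma> (\<lambda>a b c d. ?e c d * ?e d a) + \<Sigma> (\<lambda>a b c d. ?e d a * ?e a b)) + rem4 x"
    unfolding distrib scale by (simp add: rem4_def \<Sigma>_def case_prod_unfold sum.distrib sum_distrib_left distrib_left)
  also have "\<Sigma> (\<lambda>a b c d. ?e d a) = \<Sigma> (\<lambda>a b c d. ?e c d)" by (rule rot)
  also have "\<Sigma> (\<lambda>a b c d. ?e c d) = \<Sigma> (\<lambda>a b c d. ?e b c)" by (rule rot)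
  also have "\<Sigma> (\<lambda>a b c d. ?e b c) = \<Sigma> (\<lambda>a b c d. ?e a b)" by (rule rot)
  also have "\<Sigma> (\<lambda>a b c d. ?e d a * ?e a b) = \<Sigma> (\<lambda>a b c d. ?e c d * ?e d a)" by (rule rot)
  also have "\<Sigma> (\<lambda>a b c d. ?e c d * ?e d a) = \<Sigma> (\<lambda>a b c d. ?e b c * ?e c d)" by (rule rot)
  also have "\<Sigma> (\<lambda>a b c d. ?e b c * ?e c d) = \<Sigma> (\<lambda>a b c d. ?e a b * ?e b c)" by (rule rot)
  also have "\<Sigma> (\<lambda>a b c d. ?e a b * ?e b c) = (real n - 3) * (2 * S x)"
    unfolding \<Sigma>_def sum_cherries[symmetric]
    using sum_tuples4[of V "\<lambda>a b c. ?e a b * ?e b c"] by simp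
  also have "\<Sigma> (\<lambda>a b c d. ?e a b) = card (tuples4 V) * mean_noise x"
  proof -
    have "\<Sigma> (\<lambda>a b c d. ?e a b) = (real n - 3) * ((real n - 2) * (\<Sum>(a, b)\<in>tuples2 V. ?e a b))"
      unfolding \<Sigma>_def using sum_tuples4[of V "\<lambda>a b c. ?e a b"] sum_tuples3[of V "\<lambda>a b. ?e a b"] by simp
    also have "(\<Sum>(a, b)\<in>tuples2 V. ?e a b) = (real n * (real n - 1)) * mean_noise x"
      using n_ge_4 unfolding mean_noise_def card_tuples_V by auto
    finally show ?thesis unfolding card_tuples_V by (simp only: mult_ac)
  qed
  also have "\<Sigma> (\<lambda>a b c d. p ^ 4) = card (tuples4 V) * p ^ 4"
    by (simp add: \<Sigma>_def case_prod_unfold)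
  finally show ?thesis by (simp add: algebra_simps)
qed

lemma t_hat_C4_bit_graph:
  "t_hat C4 (bit_graph n x) = p ^ 4 + 4 * p ^ 3 * mean_noise x +
     8 * p\<^sup>2 / (real n * (real n - 1) * (real n - 2)) * S x + rem4 x / card (tuples4 V)"
proof -
  have "(\<Sum>(a, b, c, d)\<in>tuples4 V. of_bool ({a, b} \<in> edges (bit_graph n x)) *
      of_bool ({b, c} \<in> edges (bit_graph n x)) * of_bool ({c, d} \<in> edges (bit_graph n x)) *
      of_bool ({d, a} \<in> edges (bit_graph n x))) =
     (\<Sum>(a, b, c, d)\<in>tuples4 V. (p + noise {a, b} x) * (p + noise {b, c} x) *
       (p + noise {c, d} x) * (p + noise {d, a} x))"
  proof (intro sum.cong refl, clarify)
    fix a b c d assume "(a, b, c, d) \<in> tuples4 V"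
    hence "a \<in> V" "b \<in> V" "c \<in> V" "d \<in> V" "a \<noteq> b" "b \<noteq> c" "c \<noteq> d" "d \<noteq> a"
      by (auto simp: tuples_defs)
    thus "of_bool ({a, b} \<in> edges (bit_graph n x)) *
      of_bool ({b, c} \<in> edges (bit_graph n x)) * of_bool ({c, d} \<in> edges (bit_graph n x)) *
      of_bool ({d, a} \<in> edges (bit_graph n x)) = (p + noise {a, b} x) * (p + noise {b, c} x) *
       (p + noise {c, d} x) * (p + noise {d, a} x)"
      by (simp only: of_bool_edge not_False_eq_True)
  qed
  moreover have "t_hat C4 (bit_graph n x) =
      (\<Sum>(a, b, c, d)\<in>tuples4 V. of_bool ({a, b} \<in> edges (bit_graph n x)) *
        of_bool ({b, c} \<in> edges (bit_graph n x)) * of_bool ({c, d} \<in> edges (bit_graph n x)) *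
        of_bool ({d, a} \<in> edges (bit_graph n x))) / card (tuples4 V)"
    unfolding card_tuples_V using t_hat_C4[of "bit_graph n x"] by (simp add: bit_graph_def)
  ultimately have "t_hat C4 (bit_graph n x) = (card (tuples4 V) * (p ^ 4 + 4 * p ^ 3 * mean_noise x) +
      8 * p\<^sup>2 * (real n - 3) * S x + rem4 x) / card (tuples4 V)"
    by (simp only: sum_tuples4_edges)
  also have "\<dots> = p ^ 4 + 4 * p ^ 3 * mean_noise x +
      8 * p\<^sup>2 * (real n - 3) * S x / card (tuples4 V) + rem4 x / card (tuples4 V)"
    using tuples_V_nonempty(2) by (simp add: add_divide_distrib)
  also have "8 * p\<^sup>2 * (real n - 3) * S x / card (tuples4 V) =
      8 * p\<^sup>2 / (real n * (real n - 1) * (real n - 2)) * S x"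
    using n_ge_4 unfolding card_tuples_V by (simp add: mult_ac)
  finally show ?thesis .
qed

lemma expect_mean_noise_squared_le: "expect (\<lambda>x. (mean_noise x)\<^sup>2) \<le> 2 / card (tuples2 V)"
proof -
  define m where "m = real (card (tuples2 V))"
  have m: "0 < m" using card_tuples_V_pos by (simp add: m_def)
  have "expect (\<lambda>x. (\<Sum>t\<in>tuples2 V. 1 * chi {{fst t, snd t}} x)\<^sup>2) \<le> real 2 * (\<Sum>t\<in>tuples2 V. 1\<^sup>2)"
  proof (rule second_moment_le)
    fix t assume t: "t \<in> tuples2 V"
    show "card {u \<in> tuples2 V. {{fst u, snd u}} = {{fst t, snd t}}} \<le> 2"
      using card_doubleton_fibre_le[of "tuples2 V" t] by simp
    show "{{fst t, snd t}} \<subseteq> slots n"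
      using t by (auto simp: tuples2_def doubleton_in_slots_iff)
  qed simp
  moreover have "m * mean_noise x = (\<Sum>t\<in>tuples2 V. 1 * chi {{fst t, snd t}} x)" for x
    unfolding mean_noise_def m_def[symmetric] using m by (simp add: case_prod_unfold)
  ultimately have "expect (\<lambda>x. (m * mean_noise x)\<^sup>2) \<le> 2 * m"
    by (simp add: m_def)
  hence "m\<^sup>2 * expect (\<lambda>x. (mean_noise x)\<^sup>2) \<le> 2 * m"
    by (simp add: power_mult_distrib)
  thus ?thesis unfolding m_def[symmetric] using m by (simp add: field_simps power2_eq_square)
qed

lemma abs_mean_noise_le_1: "\<bar>mean_noise x\<bar> \<le> 1"
proof -
  have "\<bar>\<Sum>(a, b)\<in>tuples2 V. noise {a, b} x\<bar> \<le> (\<Sum>t\<in>tuples2 V. 1)"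
    by (rule order_trans[OF sum_abs]) (auto intro!: sum_mono simp: abs_noise_le_1 case_prod_unfold simp del: sum_constant)
  thus ?thesis using card_tuples_V_pos(1) by (simp add: mean_noise_def)
qed

text \<open>The terms \<open>p ^ 4\<close> and \<open>4 * p ^ 3 * mean_noise x\<close> are common to both densities and cancel. What is
  left of the fourth power of the edge density is at most \<open>11 = 6 + 4 + 1\<close> times the square of
  \<open>mean_noise x\<close>, and the other error is \<open>rem4 x\<close>. Both are of order \<open>1 / n\<^sup>2\<close> in mean.\<close>

lemma expect_f_hat_error_le:
  "expect (\<lambda>x. \<bar>f_hat (bit_graph n x) + 8 * p\<^sup>2 / (real n * (real n - 1) * (real n - 2)) * S x\<bar>)
    \<le> 22 / card (tuples2 V) + 112 / sqrt (card (tuples4 V))"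
proof -
  define m where "m = real (card (tuples4 V))"
  have m: "0 < m" using card_tuples_V_pos by (simp add: m_def)
  have "\<bar>f_hat (bit_graph n x) + 8 * p\<^sup>2 / (real n * (real n - 1) * (real n - 2)) * S x\<bar>
      \<le> 11 * (mean_noise x)\<^sup>2 + \<bar>rem4 x\<bar> / m" for x
  proof -
    define y where "y = mean_noise x"
    have y: "\<bar>y\<bar> \<le> 1" unfolding y_def by (rule abs_mean_noise_le_1)
    have eq: "f_hat (bit_graph n x) + 8 * p\<^sup>2 / (real n * (real n - 1) * (real n - 2)) * S x =
        y\<^sup>2 * (6 * p\<^sup>2 + 4 * p * y + y\<^sup>2) - rem4 x / m"
      unfolding f_hat_def t_hat_K2_bit_graph t_hat_C4_bit_graph
      by (simp add: y_def m_def eval_nat_numeral algebra_simps)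
    have "\<bar>6 * p\<^sup>2 + 4 * p * y + y\<^sup>2\<bar> \<le> 6 * \<bar>p\<^sup>2\<bar> + 4 * \<bar>p * y\<bar> + \<bar>y\<^sup>2\<bar>"
      by linarith
    also have "\<dots> \<le> 6 * 1 + 4 * 1 + 1"
      using y p_pos p_less_1 by (intro add_mono mult_left_mono) (auto simp: abs_mult mult_le_one power_le_one abs_square_le_1)
    finally have "y\<^sup>2 * \<bar>6 * p\<^sup>2 + 4 * p * y + y\<^sup>2\<bar> \<le> y\<^sup>2 * 11"
      by (intro mult_left_mono) auto
    hence "\<bar>y\<^sup>2 * (6 * p\<^sup>2 + 4 * p * y + y\<^sup>2)\<bar> \<le> 11 * y\<^sup>2" by (simp add: abs_mult)
    moreover have "\<bar>rem4 x / m\<bar> = \<bar>rem4 x\<bar> / m" using m by simp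
    ultimately show ?thesis unfolding eq y_def[symmetric] by linarith
  qed
  hence "expect (\<lambda>x. \<bar>f_hat (bit_graph n x) + 8 * p\<^sup>2 / (real n * (real n - 1) * (real n - 2)) * S x\<bar>)
      \<le> expect (\<lambda>x. 11 * (mean_noise x)\<^sup>2 + \<bar>rem4 x\<bar> / m)"
    by (rule expect_mono)
  also have "\<dots> = 11 * expect (\<lambda>x. (mean_noise x)\<^sup>2) + expect (\<lambda>x. \<bar>rem4 x\<bar>) / m"
    by simp
  also have "\<dots> \<le> 11 * (2 / card (tuples2 V)) + (112 * sqrt m) / m"
    using m expect_rem4_le
    by (intro add_mono mult_left_mono divide_right_mono expect_mean_noise_squared_le) (auto simp: m_def)
  also have "(112 * sqrt m) / m = 112 / sqrt m"
    using m by (simp add: field_simps)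
  finally show ?thesis by (simp add: m_def)
qed

text \<open>Up to sign, \<open>\<tau> / t\<close> is the standard deviation of the rescaled leading term, since that of \<open>S\<close> is
  \<open>var * sqrt (n * (n - 1) * (n - 2) / 2)\<close>. The first error comes from dropping the other terms and the
  second from the normal approximation of \<open>S\<close>.\<close>

lemma char_f_hat_bit_graph:
  fixes t :: real
  defines "\<tau> \<equiv> t * (8 * p\<^sup>2 * var * (real n powr (3 / 2) / sqrt (2 * (real n * (real n - 1) * (real n - 2)))))"
  shows "norm (expect (\<lambda>x. iexp (t * (real n powr (3 / 2) * f_hat (bit_graph n x)))) -
      complex_of_real (exp (- \<tau>\<^sup>2 / 2)))
    \<le> \<bar>t\<bar> * (real n powr (3 / 2) * (22 / (real n * (real n - 1)) +
        112 / sqrt (real n * (real n - 1) * (real n - 2) * (real n - 3)))) +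
      17 / var ^ 3 * sqrt (4 * (real n - 2) / (real n * (real n - 1))) * (\<tau>\<^sup>2 + \<bar>\<tau>\<bar> ^ 3)"
proof -
  define w m where "w = real n powr (3 / 2)" and "m = real n * (real n - 1) * (real n - 2)"
  define s where "s = var * sqrt (card (slots n) * real (2 * (n - 2)) / 2)"
  have m: "0 < m" using n_ge_4 by (simp add: m_def)
  have d: "real (2 * (n - 2)) = 2 * (real n - 2)" using n_ge_4 by (simp add: of_nat_diff)
  have card: "real (card (slots n)) = real n * (real n - 1) / 2"
    using n_ge_4 by (simp add: card_slots choose_two real_of_nat_div of_nat_diff)
  have s: "s = var * sqrt (m / 2)"
    unfolding s_def d card by (simp add: m_def)
  have \<tau>: "\<tau> / s = t * (w * (8 * p\<^sup>2 / m))"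
  proof -
    have "sqrt (2 * m) * sqrt (m / 2) = m"
      using m by (simp flip: real_sqrt_mult)
    thus ?thesis
      using m var_pos unfolding \<tau>_def s w_def[symmetric] m_def[symmetric] by (simp add: field_simps)
  qed
  have "norm (expect (\<lambda>x. iexp (t * (w * f_hat (bit_graph n x)))) - expect (\<lambda>x. iexp (- \<tau> * (S x / s))))
      = norm (expect (\<lambda>x. iexp (t * (w * f_hat (bit_graph n x))) - iexp (- \<tau> * (S x / s))))"
    by simp
  also have "\<dots> \<le> expect (\<lambda>x. norm (iexp (t * (w * f_hat (bit_graph n x))) - iexp (- \<tau> * (S x / s))))"
    by (rule expect_norm_le)
  also have "\<dots> \<le> expect (\<lambda>x. \<bar>t\<bar> * (w * \<bar>f_hat (bit_graph n x) + 8 * p\<^sup>2 / m * S x\<bar>))"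
  proof (rule expect_mono)
    fix x
    have "t * (w * f_hat (bit_graph n x)) - - \<tau> * (S x / s) =
        t * (w * f_hat (bit_graph n x)) + (\<tau> / s) * S x"
      by simp
    also have "\<dots> = t * (w * (f_hat (bit_graph n x) + 8 * p\<^sup>2 / m * S x))"
      unfolding \<tau> by (simp add: algebra_simps)
    finally show "norm (iexp (t * (w * f_hat (bit_graph n x))) - iexp (- \<tau> * (S x / s))) \<le>
        \<bar>t\<bar> * (w * \<bar>f_hat (bit_graph n x) + 8 * p\<^sup>2 / m * S x\<bar>)"
      using norm_iexp_diff_le[of "t * (w * f_hat (bit_graph n x))" "- \<tau> * (S x / s)"]
      by (simp add: abs_mult w_def)
  qed
  also have "\<dots> = \<bar>t\<bar> * (w * expect (\<lambda>x. \<bar>f_hat (bit_graph n x) + 8 * p\<^sup>2 / m * S x\<bar>))"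
    by simp
  also have "\<dots> \<le> \<bar>t\<bar> * (w * (22 / card (tuples2 V) + 112 / sqrt (card (tuples4 V))))"
    using expect_f_hat_error_le unfolding m_def by (intro mult_left_mono) (auto simp: w_def)
  finally have 1: "norm (expect (\<lambda>x. iexp (t * (w * f_hat (bit_graph n x)))) -
      expect (\<lambda>x. iexp (- \<tau> * (S x / s)))) \<le> \<dots>" .
  have 2: "norm (expect (\<lambda>x. iexp (- \<tau> * (S x / s))) - complex_of_real (exp (- \<tau>\<^sup>2 / 2)))
      \<le> 17 / var ^ 3 * sqrt (real (2 * (n - 2)) / card (slots n)) * (\<tau>\<^sup>2 + \<bar>\<tau>\<bar> ^ 3)"
    using char_quadratic_form[of "- \<tau>"] unfolding s_def by simp
  have 3: "real (2 * (n - 2)) / card (slots n) = 4 * (real n - 2) / (real n * (real n - 1))"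
    unfolding d card by simp
  show ?thesis
    using norm_triangle_le[OF add_mono[OF 1 2]] unfolding 3 card_tuples_V w_def by simp
qed

end

section \<open>The law of the graph of an almost constant graphon\<close>

text \<open>For \<open>i < j\<close> the labels \<open>U i\<close> and \<open>U j\<close> are jointly uniform on the square, hence almost surely
  outside the null set on which \<open>W\<close> differs from \<open>p\<close>.\<close>

lemma AE_label_space_W_eq:
  fixes W :: "real \<times> real \<Rightarrow> real"
  assumes W: "graphon W" and ae: "AE z in lborel. z \<in> unit_square \<longrightarrow> W z = p"
  shows "AE \<omega> in label_space n. \<forall>(i, j)\<in>vertex_pairs n. W (fst \<omega> i, fst \<omega> j) = p"
proof -
  interpret u: prob_space uniform01 by (rule prob_space_uniform01)
  interpret uu: pair_prob_space uniform01 uniform01 ..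
  interpret PU: product_prob_space "\<lambda>_ :: nat. uniform01" "{1..n}" ..
  interpret B: prob_space "\<Pi>\<^sub>M ij\<in>vertex_pairs n. uniform01"
    by (intro prob_space_PiM prob_space_uniform01)
  interpret L: pair_prob_space "\<Pi>\<^sub>M i\<in>{1..n}. uniform01" "\<Pi>\<^sub>M ij\<in>vertex_pairs n. uniform01" ..
  have sp: "space uniform01 = {0..1}" by (simp add: uniform01_def space_restrict_space)
  have id01: "(\<lambda>x. x) \<in> borel_measurable uniform01"
    unfolding uniform01_def by (rule measurable_restrict_space1) simp
  have "(\<lambda>z. z) \<in> measurable (uniform01 \<Otimes>\<^sub>M uniform01) (restrict_space borel unit_square)"
  proof (rule measurable_restrict_space2)
    show "(\<lambda>z. z) \<in> space (uniform01 \<Otimes>\<^sub>M uniform01) \<rightarrow> unit_square"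
      by (auto simp: space_pair_measure sp)
    have "(\<lambda>z. (fst z, snd z)) \<in> borel_measurable (uniform01 \<Otimes>\<^sub>M uniform01)"
      using measurable_compose[OF measurable_fst id01] measurable_compose[OF measurable_snd id01]
      by (rule borel_measurable_Pair)
    thus "(\<lambda>z. z) \<in> borel_measurable (uniform01 \<Otimes>\<^sub>M uniform01)" by simp
  qed
  hence Wm: "W \<in> borel_measurable (uniform01 \<Otimes>\<^sub>M uniform01)"
    using W by (auto simp: graphon_def intro: measurable_compose[of "\<lambda>z. z"])
  have set: "{z \<in> space (uniform01 \<Otimes>\<^sub>M uniform01). W z = p} \<in> sets (uniform01 \<Otimes>\<^sub>M uniform01)"
    using Wm by measurable
  have sq: "AE z in uniform01 \<Otimes>\<^sub>M uniform01. W z = p"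
  proof (rule uu.AE_pair_measure[OF set])
    have "AE z in lborel \<Otimes>\<^sub>M lborel. z \<in> unit_square \<longrightarrow> W z = p"
      using ae unfolding lborel_prod .
    hence "AE x in lborel. AE y in lborel. (x, y) \<in> unit_square \<longrightarrow> W (x, y) = p"
      by (rule lborel_pair.AE_pair)
    thus "AE x in uniform01. AE y in uniform01. W (x, y) = p"
      unfolding uniform01_def by (auto simp: AE_restrict_space_iff elim!: eventually_mono)
  qed
  have one: "AE U in (\<Pi>\<^sub>M i\<in>{1..n}. uniform01). W (U i, U j) = p" if ij: "(i, j) \<in> vertex_pairs n" for i j
  proof -
    let ?P = "\<Pi>\<^sub>M i\<in>{1..n}. uniform01"
    have meas [measurable]: "(\<lambda>U. (U i, U j)) \<in> measurable ?P (uniform01 \<Otimes>\<^sub>M uniform01)"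
      using ij by (intro measurable_Pair measurable_component_singleton) auto
    have "uniform01 \<Otimes>\<^sub>M uniform01 = distr ?P (uniform01 \<Otimes>\<^sub>M uniform01) (\<lambda>U. (U i, U j))"
    proof (rule pair_measure_eqI)
      fix A B assume AB: "A \<in> sets uniform01" "B \<in> sets uniform01"
      have "emeasure (distr ?P (uniform01 \<Otimes>\<^sub>M uniform01) (\<lambda>U. (U i, U j))) (A \<times> B) =
          emeasure ?P ((\<lambda>U. (U i, U j)) -` (A \<times> B) \<inter> space ?P)"
        using AB by (intro emeasure_distr meas) auto
      also have "(\<lambda>U. (U i, U j)) -` (A \<times> B) \<inter> space ?P =
          {U \<in> space ?P. \<forall>k\<in>{i, j}. U k \<in> (if k = i then A else B)}"
        using ij by auto
      also have "emeasure ?P \<dots> = (\<Prod>k\<in>{i, j}. emeasure uniform01 (if k = i then A else B))"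
        using ij AB by (intro PU.emeasure_PiM_Collect) auto
      also have "\<dots> = emeasure uniform01 A * emeasure uniform01 B"
        using ij by auto
      finally show "emeasure uniform01 A * emeasure uniform01 B =
          emeasure (distr ?P (uniform01 \<Otimes>\<^sub>M uniform01) (\<lambda>U. (U i, U j))) (A \<times> B)" ..
    qed (auto intro: u.sigma_finite_measure_axioms)
    from subst[OF this, of "\<lambda>M. AE z in M. W z = p", OF sq]
    have "AE z in distr ?P (uniform01 \<Otimes>\<^sub>M uniform01) (\<lambda>U. (U i, U j)). W z = p" .
    thus ?thesis by (rule AE_distrD[rotated]) measurable
  qed
  have fin: "finite (vertex_pairs n)"
    by (rule finite_subset[of _ "{1..n} \<times> {1..n}"]) auto
  have "AE U in (\<Pi>\<^sub>M i\<in>{1..n}. uniform01). \<forall>ij\<in>vertex_pairs n. W (U (fst ij), U (snd ij)) = p"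
    by (rule AE_finite_allI[OF fin]) (use one in auto)
  hence "AE U in distr (label_space n) (\<Pi>\<^sub>M i\<in>{1..n}. uniform01) fst.
      \<forall>ij\<in>vertex_pairs n. W (U (fst ij), U (snd ij)) = p"
    unfolding label_space_def B.distr_pair_fst .
  hence "AE \<omega> in label_space n. \<forall>ij\<in>vertex_pairs n. W (fst \<omega> (fst ij), fst \<omega> (snd ij)) = p"
    by (rule AE_distrD[rotated]) (simp add: label_space_def)
  thus ?thesis by (auto simp: case_prod_unfold)
qed

lemma bij_betw_vertex_pairs_slots: "bij_betw (\<lambda>(i, j). {i, j}) (vertex_pairs n) (slots n)"
  unfolding bij_betw_def
proof (intro conjI equalityI subsetI)
  show "inj_on (\<lambda>(i, j). {i, j}) (vertex_pairs n)"
    by (auto simp: inj_on_def doubleton_eq_iff)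
next
  fix e assume "e \<in> slots n"
  then obtain a b where e: "e = {a, b}" "a \<noteq> b" "a \<in> {1..n}" "b \<in> {1..n}" by (rule slotsE)
  hence "(min a b, max a b) \<in> vertex_pairs n" "e = {min a b, max a b}"
    by (auto simp: min_def max_def)
  thus "e \<in> (\<lambda>(i, j). {i, j}) ` vertex_pairs n"
    by (intro image_eqI[of _ _ "(min a b, max a b)"]) simp_all
qed (auto simp: slots_def)

lemma emeasure_uniform01_threshold:
  assumes "0 \<le> p" "p \<le> 1"
  shows "{y \<in> {0..1}. (y \<le> p) = b} \<in> sets uniform01"
    and "emeasure uniform01 {y \<in> {0..1}. (y \<le> p) = b} = ennreal (if b then p else 1 - p)"
proof -
  have eq: "{y \<in> {0..1}. (y \<le> p) = b} = (if b then {0..p} else {p<..1})"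
    using assms by auto
  show "{y \<in> {0..1}. (y \<le> p) = b} \<in> sets uniform01"
    unfolding eq using assms by (auto simp: uniform01_def sets_restrict_space_iff)
  show "emeasure uniform01 {y \<in> {0..1}. (y \<le> p) = b} = ennreal (if b then p else 1 - p)"
    unfolding eq uniform01_def using assms
    by (subst emeasure_restrict_space) (auto simp: not_le)
qed

text \<open>Both laws live on a finite set of graphs. On either side, the probability of a graph
  \<open>g\<close> is a product over all pairs of vertices, with factor \<open>p\<close> for the edges of \<open>g\<close> and \<open>1 - p\<close> for the
  other pairs.\<close>

lemma random_graph_almost_constant:
  fixes W :: "real \<times> real \<Rightarrow> real"
  assumes W: "graphon W" and p: "0 \<le> p" "p \<le> 1"
    and ae: "AE z in lborel. z \<in> unit_square \<longrightarrow> W z = p"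
  shows "random_graph n W = distr (measure_pmf (Pi_pmf (slots n) False (\<lambda>_. bernoulli_pmf p)))
      (count_space (simple_graphs_on {1..n})) (bit_graph n)" (is "?L = ?R")
proof -
  let ?Q = "Pi_pmf (slots n) False (\<lambda>_. bernoulli_pmf p)"
  let ?U = "\<Pi>\<^sub>M i\<in>{1..n}. uniform01" and ?Y = "\<Pi>\<^sub>M ij\<in>vertex_pairs n. uniform01"
  interpret PU: product_prob_space "\<lambda>_ :: nat. uniform01" "{1..n}"
    using prob_space_uniform01 by (simp add: product_prob_space_def product_prob_space_axioms_def product_sigma_finite_def prob_space_imp_sigma_finite)
  interpret PY: product_prob_space "\<lambda>_ :: nat \<times> nat. uniform01" "vertex_pairs n"
    using prob_space_uniform01 by (simp add: product_prob_space_def product_prob_space_axioms_def product_sigma_finite_def prob_space_imp_sigma_finite)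
  have Y: "prob_space ?Y"
    by (intro prob_space_PiM prob_space_uniform01)
  have sp: "space uniform01 = {0..1}" by (simp add: uniform01_def space_restrict_space)
  have fin: "finite (vertex_pairs n)"
    by (rule finite_subset[of _ "{1..n} \<times> {1..n}"]) auto
  show ?thesis
  proof (rule measure_eqI_finite)
    show "finite (simple_graphs_on {1..n})" by (simp add: finite_simple_graphs_on)
    fix g :: "nat graph" assume g: "g \<in> simple_graphs_on {1..n}"
    have gE: "fst g = {1..n}" "snd g \<subseteq> slots n" using g by (auto simp: simple_graphs_on_def slots_def)
    define b where "b = (\<lambda>ij :: nat \<times> nat. {fst ij, snd ij} \<in> edges g)"
    define T where "T = {Y \<in> space ?Y. \<forall>ij\<in>vertex_pairs n. Y ij \<in> {y \<in> {0..1}. (y \<le> p) = b ij}}"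
    have T: "T \<in> sets ?Y" unfolding T_def
      by (rule sets.sets_Collect_finite_All[OF _ fin])
         (use emeasure_uniform01_threshold(1)[OF p] in measurable)
    have "emeasure ?L {g} = emeasure (label_space n) (sample_graph n W -` {g} \<inter> space (label_space n))"
      unfolding random_graph_def using g by (intro emeasure_distr measurable_sample_graph W) auto
    also have "\<dots> = emeasure (label_space n) (space ?U \<times> T)"
    proof (rule emeasure_eq_AE)
      show "AE \<omega> in label_space n. \<omega> \<in> sample_graph n W -` {g} \<inter> space (label_space n) \<longleftrightarrow>
          \<omega> \<in> space ?U \<times> T"
        using AE_label_space_W_eq[OF W ae, of n] AE_space
      proof eventually_elim
        case (elim \<omega>)
        obtain U Y where \<omega>: "\<omega> = (U, Y)" by (cases \<omega>)
        have U: "U \<in> space ?U" and Y: "Y \<in> space ?Y"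
          using elim(2) by (auto simp: \<omega> label_space_def space_pair_measure)
        have Y01: "Y ij \<in> {0..1}" if "ij \<in> vertex_pairs n" for ij
          using Y that by (auto simp: space_PiM sp PiE_iff)
        have "sample_graph n W \<omega> = g \<longleftrightarrow> edges (sample_graph n W \<omega>) = edges g"
          using gE(1) by (auto simp: prod_eq_iff sample_graph_def \<omega>)
        also have "\<dots> \<longleftrightarrow> (\<forall>e\<in>slots n. e \<in> edges (sample_graph n W \<omega>) \<longleftrightarrow> e \<in> edges g)"
          using gE(2) sample_graph_in[of n W \<omega>] by (auto simp: simple_graphs_on_def slots_def)
        also have "\<dots> \<longleftrightarrow> (\<forall>ij\<in>vertex_pairs n. {fst ij, snd ij} \<in> edges (sample_graph n W \<omega>) \<longleftrightarrow> b ij)"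
          unfolding bij_betw_imp_surj_on[OF bij_betw_vertex_pairs_slots, symmetric] b_def
          by (simp add: case_prod_unfold)
        also have "\<dots> \<longleftrightarrow> (\<forall>ij\<in>vertex_pairs n. (Y ij \<le> p) = b ij)"
        proof (intro ball_cong refl)
          fix ij assume ij: "ij \<in> vertex_pairs n"
          obtain i j where [simp]: "ij = (i, j)" by (cases ij)
          have "W (U i, U j) = p" using elim(1) ij by (auto simp: \<omega>)
          thus "({fst ij, snd ij} \<in> edges (sample_graph n W \<omega>) \<longleftrightarrow> b ij) = ((Y ij \<le> p) = b ij)"
            using sample_graph_edge_iff[of i j n W U Y] ij by (simp add: \<omega>)
        qed
        also have "\<dots> \<longleftrightarrow> Y \<in> T"
          using Y Y01 by (auto simp: T_def)
        finally show ?case using elim(2) U by (auto simp: \<omega>)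
      qed
      show "sample_graph n W -` {g} \<inter> space (label_space n) \<in> sets (label_space n)"
        using g by (intro measurable_sets[OF measurable_sample_graph[OF W]]) simp
      show "space ?U \<times> T \<in> sets (label_space n)"
        unfolding label_space_def using T by auto
    qed
    also have "\<dots> = emeasure ?Y T"
      unfolding label_space_def PU.emeasure_space_1 mult_1
        sigma_finite_measure.emeasure_pair_measure_Times[OF prob_space_imp_sigma_finite[OF Y] sets.top T] ..
    also have "\<dots> = (\<Prod>ij\<in>vertex_pairs n. emeasure uniform01 {y \<in> {0..1}. (y \<le> p) = b ij})"
      unfolding T_def
      by (intro PY.emeasure_PiM_Collect emeasure_uniform01_threshold(1)[OF p] order_refl fin)
    also have "\<dots> = (\<Prod>ij\<in>vertex_pairs n. ennreal (if b ij then p else 1 - p))"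
      by (simp only: emeasure_uniform01_threshold(2)[OF p])
    also have "\<dots> = ennreal (\<Prod>ij\<in>vertex_pairs n. if b ij then p else 1 - p)"
      using p by (intro prod_ennreal) auto
    also have "(\<Prod>ij\<in>vertex_pairs n. if b ij then p else 1 - p) =
        (\<Prod>e\<in>slots n. if e \<in> edges g then p else 1 - p)"
      by (subst prod.reindex_bij_betw[OF bij_betw_vertex_pairs_slots, symmetric])
         (simp add: b_def case_prod_unfold)
    also have "\<dots> = (\<Prod>e\<in>slots n. measure_pmf.prob (bernoulli_pmf p) {e \<in> edges g})"
      using p by (intro prod.cong refl) (auto simp: measure_pmf_single)
    also have "\<dots> = measure_pmf.prob ?Q (Pi (slots n) (\<lambda>e. {e \<in> edges g}))"
      by (rule measure_Pi_pmf_Pi[OF finite_slots, symmetric])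
    also have "ennreal \<dots> = emeasure (measure_pmf ?Q) (bit_graph n -` {g} \<inter> space (measure_pmf ?Q))"
    proof -
      have *: "x \<in> Pi (slots n) (\<lambda>e. {e \<in> edges g}) \<longleftrightarrow> {e \<in> slots n. x e} = edges g" for x
        unfolding Pi_iff set_eq_iff singleton_iff mem_Collect_eq
        using gE(2)[unfolded subset_iff] by metis
      have "Pi (slots n) (\<lambda>e. {e \<in> edges g}) = bit_graph n -` {g} \<inter> space (measure_pmf ?Q)"
        by (intro set_eqI) (simp add: * bit_graph_def prod_eq_iff gE(1) del: Pi_iff)
      thus ?thesis by (simp add: measure_pmf.emeasure_eq_measure)
    qed
    also have "\<dots> = emeasure ?R {g}"
      using g by (intro emeasure_distr[symmetric] measurable_bit_graph) auto
    finally show "emeasure ?L {g} = emeasure ?R {g}" .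
  qed (simp_all add: random_graph_def)
qed

lemma t_K2_almost_constant:
  assumes W: "graphon W" and ae: "AE z in lborel. z \<in> unit_square \<longrightarrow> W z = p"
  shows "t_K2 W = p"
proof -
  have sets: "unit_square \<in> sets borel" by (intro borel_closed closed_Times) auto
  have "t_K2 W = (LINT z:unit_square|lborel. p)"
    unfolding t_K2_def set_lebesgue_integral_def
  proof (rule integral_cong_AE)
    show "(\<lambda>z. indicat_real unit_square z *\<^sub>R W z) \<in> borel_measurable lborel"
      using W sets by (simp add: graphon_def borel_measurable_restrict_space_iff mult.commute)
    show "AE z in lborel. indicat_real unit_square z *\<^sub>R W z = indicat_real unit_square z *\<^sub>R p"
      using ae by eventually_elim (auto simp: indicator_def)
  qed (use sets in auto)
  also have "\<dots> = p"
  proof -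
    have cbox: "unit_square = cbox (0, 0) (1, 1 :: real)" by (simp add: cbox_Pair_eq)
    have "measure lborel unit_square = 1"
      unfolding cbox by (simp add: content_Pair)
    moreover have "integrable lborel (indicat_real unit_square)"
      unfolding cbox by (rule integrable_real_indicator) (use emeasure_bounded_finite[OF bounded_cbox] in simp_all)
    ultimately show ?thesis
      unfolding set_lebesgue_integral_def by (subst integral_scaleR_left) simp_all
  qed
  finally show ?thesis .
qed

section \<open>The limit theorem\<close>

theorem proposition6p1:
  fixes W :: "real \<times> real \<Rightarrow> real" and p :: real
    and M :: "nat \<Rightarrow> 'a measure" and G :: "nat \<Rightarrow> 'a \<Rightarrow> nat graph"
  assumes "graphon W"
    and "0 < p" and "p < 1"
    and "AE z in lborel. z \<in> unit_square \<longrightarrow> W z = p"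
    and "\<And>n. prob_space (M n)"
    and "\<And>n. G n \<in> measurable (M n) (count_space (simple_graphs_on {1..n}))"
    and "\<And>n. distr (M n) (count_space (simple_graphs_on {1..n})) (G n) = random_graph n W"
  shows "weak_conv_m
    (\<lambda>n. distr (M n) borel (\<lambda>\<omega>. real n powr (3/2) * f_hat (G n \<omega>)))
    (density lborel (\<lambda>x. ennreal (normal_density 0 (sqrt (32 * t_K2 W ^ 6 * (1 - t_K2 W)\<^sup>2)) x)))"
proof -
  define v where "v = p * (1 - p)"
  define \<sigma> where "\<sigma> = sqrt (32 * p ^ 6 * (1 - p)\<^sup>2)"
  have v_pos: "0 < v" using assms(2,3) by (simp add: v_def)
  have \<sigma>_pos: "0 < \<sigma>" using assms(2,3) by (simp add: \<sigma>_def)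
  have \<sigma>: "\<sigma> = 8 * p\<^sup>2 * v * (1 / sqrt 2)"
  proof -
    have "32 * p ^ 6 * (1 - p)\<^sup>2 = (8 * p\<^sup>2 * v * (1 / sqrt 2))\<^sup>2"
      by (simp add: v_def power_mult_distrib power_divide flip: power_mult)
    thus ?thesis using v_pos by (simp add: \<sigma>_def)
  qed
  define X where "X = (\<lambda>n g. real n powr (3 / 2) * f_hat (g :: nat graph))"
  define Q where "Q = (\<lambda>n. Pi_pmf (slots n) False (\<lambda>_. bernoulli_pmf p))"
  have X_meas: "X n \<in> borel_measurable (count_space (simple_graphs_on {1..n}))" for n
    by simp
  have XG_meas: "(\<lambda>\<omega>. X n (G n \<omega>)) \<in> borel_measurable (M n)" for n
    using measurable_compose[OF assms(6) X_meas] .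
  have char_eq: "char (distr (M n) borel (\<lambda>\<omega>. X n (G n \<omega>))) t =
      measure_pmf.expectation (Q n) (\<lambda>x. iexp (t * X n (bit_graph n x)))" for n t
  proof -
    have "char (distr (M n) borel (\<lambda>\<omega>. X n (G n \<omega>))) t = (CLINT \<omega>|M n. iexp (t * X n (G n \<omega>)))"
      unfolding char_def by (rule integral_distr[OF XG_meas]) simp
    also have "\<dots> = (CLINT g|distr (M n) (count_space (simple_graphs_on {1..n})) (G n). iexp (t * X n g))"
      by (rule integral_distr[symmetric, OF assms(6)]) simp
    also have "distr (M n) (count_space (simple_graphs_on {1..n})) (G n) =
        distr (measure_pmf (Q n)) (count_space (simple_graphs_on {1..n})) (bit_graph n)"
      unfolding assms(7) Q_def using assms(2,3) by (intro random_graph_almost_constant assms(1,4)) auto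
    also have "(CLINT g|\<dots>. iexp (t * X n g)) = measure_pmf.expectation (Q n) (\<lambda>x. iexp (t * X n (bit_graph n x)))"
      by (rule integral_distr[OF measurable_bit_graph]) simp
    finally show ?thesis .
  qed
  have "weak_conv_m (\<lambda>n. distr (M n) borel (\<lambda>\<omega>. X n (G n \<omega>)))
      (density lborel (\<lambda>x. ennreal (normal_density 0 \<sigma> x)))"
  proof (rule levy_continuity)
    show "real_distribution (distr (M n) borel (\<lambda>\<omega>. X n (G n \<omega>)))" for n
      by (rule prob_space.real_distribution_distr[OF assms(5) XG_meas])
    show "real_distribution (density lborel (\<lambda>x. ennreal (normal_density 0 \<sigma> x)))"
      using prob_space_normal_density[OF \<sigma>_pos, of 0]
      by (simp add: real_distribution_def real_distribution_axioms_def)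
    fix t :: real
    define \<tau> where "\<tau> = (\<lambda>n. t * (8 * p\<^sup>2 * v *
      (real n powr (3 / 2) / sqrt (2 * (real n * (real n - 1) * (real n - 2))))))"
    define \<epsilon>1 where "\<epsilon>1 = (\<lambda>n. real n powr (3 / 2) * (22 / (real n * (real n - 1)) +
        112 / sqrt (real n * (real n - 1) * (real n - 2) * (real n - 3))))"
    define \<epsilon>2 where "\<epsilon>2 = (\<lambda>n. sqrt (4 * (real n - 2) / (real n * (real n - 1))))"
    have \<tau>: "\<tau> \<longlonglongrightarrow> t * \<sigma>"
    proof -
      have "(\<lambda>n. real n powr (3 / 2) / sqrt (2 * (real n * (real n - 1) * (real n - 2))))
          \<longlonglongrightarrow> inverse (2 powr (1 / 2))"
        by real_asymp
      also have "inverse (2 powr (1 / 2)) = 1 / sqrt 2"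
        by (subst powr_half_sqrt) (simp_all add: inverse_eq_divide)
      finally show ?thesis
        unfolding \<tau>_def \<sigma> by (intro tendsto_mult[OF tendsto_const])
    qed
    have \<epsilon>: "\<epsilon>1 \<longlonglongrightarrow> 0" "\<epsilon>2 \<longlonglongrightarrow> 0"
      unfolding \<epsilon>1_def \<epsilon>2_def by real_asymp+
    define err where "err = (\<lambda>n. \<bar>t\<bar> * \<epsilon>1 n + 17 / v ^ 3 * \<epsilon>2 n * ((\<tau> n)\<^sup>2 + \<bar>\<tau> n\<bar> ^ 3))"
    have "err \<longlonglongrightarrow> \<bar>t\<bar> * 0 + 17 / v ^ 3 * 0 * ((t * \<sigma>)\<^sup>2 + \<bar>t * \<sigma>\<bar> ^ 3)"
      unfolding err_def using v_pos by (intro tendsto_intros \<tau> \<epsilon>)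
    hence err: "err \<longlonglongrightarrow> 0" by simp
    have "(\<lambda>n. char (distr (M n) borel (\<lambda>\<omega>. X n (G n \<omega>))) t - complex_of_real (exp (- (\<tau> n)\<^sup>2 / 2))) \<longlonglongrightarrow> 0"
    proof (rule Lim_null_comparison[OF _ err])
      show "\<forall>\<^sub>F n in sequentially. norm (char (distr (M n) borel (\<lambda>\<omega>. X n (G n \<omega>))) t -
          complex_of_real (exp (- (\<tau> n)\<^sup>2 / 2))) \<le> err n"
        using eventually_ge_at_top[of 4]
      proof eventually_elim
        case (elim n)
        interpret random_edges n p
          using elim assms(2,3) by unfold_locales
        show ?case
          unfolding char_eq using char_f_hat_bit_graph[of t]
          unfolding Q_def X_def \<tau>_def err_def \<epsilon>1_def \<epsilon>2_def v_def P_def var_def .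
      qed
    qed
    moreover have "(\<lambda>n. complex_of_real (exp (- (\<tau> n)\<^sup>2 / 2))) \<longlonglongrightarrow> complex_of_real (exp (- (t * \<sigma>)\<^sup>2 / 2))"
      by (intro tendsto_intros \<tau>) simp
    ultimately have "(\<lambda>n. char (distr (M n) borel (\<lambda>\<omega>. X n (G n \<omega>))) t -
        complex_of_real (exp (- (\<tau> n)\<^sup>2 / 2)) + complex_of_real (exp (- (\<tau> n)\<^sup>2 / 2))) \<longlonglongrightarrow>
        0 + complex_of_real (exp (- (t * \<sigma>)\<^sup>2 / 2))"
      by (rule tendsto_add)
    hence "(\<lambda>n. char (distr (M n) borel (\<lambda>\<omega>. X n (G n \<omega>))) t) \<longlonglongrightarrow>
        complex_of_real (exp (- (t * \<sigma>)\<^sup>2 / 2))"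
      by (simp only: diff_add_cancel add_0_left)
    thus "(\<lambda>n. char (distr (M n) borel (\<lambda>\<omega>. X n (G n \<omega>))) t) \<longlonglongrightarrow>
        char (density lborel (\<lambda>x. ennreal (normal_density 0 \<sigma> x))) t"
      unfolding char_normal[OF \<sigma>_pos] .
  qed
  thus ?thesis
    unfolding X_def \<sigma>_def t_K2_almost_constant[OF assms(1,4)] .
qed

end
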